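(* Let $c\in(0,0.5]$ and consider the problem $\mathcal P\text{-MSP}_2(1,c)$ (searching the plane with two agents, of speeds $1$ and $c$). (i) If $c\le 0.0578391$, the problem admits a solution with search cost $\mathcal U_1$. (ii) If $0.0578391<c<0.268872$, there is $\phi\in(0,\pi)$ with $\gamma(\phi)=c$ such that the problem admits a solution with search cost $\mathcal R_\phi$, strictly smaller than $\mathcal U_1$, which is achieved by a strategy that partitions the plane into the cone $\mathcal C_\phi$ (all of whose points are exposed by the speed-$c$ agent) and the conic complement $\mathcal W_\phi$ (all of whose points are exposed by the unit-speed agent). (iii) If $c\ge 0.268872$, the problem admits a solution with search cost $\mathcal U_2/\sqrt c$, achieved by logarithmic-spiral trajectories, i.e. by trajectories of the form $t\mapsto\langle e^{kt},t\rangle$ for the unit-speed agent and $t\mapsto\langle c\,e^{kt},t+\phi_1\rangle$ for the speed-$c$ agent, for some $k>0$ and $\phi_1\in[0,2\pi]$.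
   Context: For $i\ge1$, $\kappa_i$ is the unique positive root of $k^3+k=\frac{i}{2\pi}$ and $\mathcal U_i=\frac{\sqrt{1+\kappa_i^2}}{\kappa_i}e^{2\pi\kappa_i/i}$ ($\mathcal U_1\approx17.28935$, $\mathcal U_2\approx 8.92852$). For $\phi\in(0,\pi)$: $\mathcal F_\phi$ is the minimum over $\theta\in(\phi,\pi/2+\phi/2)$ of $\left(\frac{\sin\theta}{\sin(\theta-\phi)}\right)^2\frac1{\cos(\theta-\phi/2)}$; $\mathcal R_\phi$ is the minimum over $\lambda\in(1,\infty)$ of $\frac{\sqrt{\lambda^2-2\lambda\cos\phi+1}}{\lambda-1}e^{2\pi k_\lambda}$, where $k_\lambda=\frac{\ln\lambda}{2\pi}+\frac{\lambda-1}{\sqrt{2\lambda(1-\cos\phi)}}\left(1-\frac{\phi}{2\pi}\right)$; and $\gamma(\phi)=\cos(\phi/2)\mathcal F_\phi/\mathcal R_\phi$. Polar notation: $\langle \rho,\chi\rangle = \rho(\cos\chi,\sin\chi)$. Ray $\mathcal L_\psi=\{\langle x,\psi\rangle:x>0\}$. $\mathcal P=\mathbb R^2\setminus\{(0,0)\}$, $\mathcal C_\phi=\bigcup_{\psi\in[0,\phi)}\mathcal L_\psi$, $\mathcal W_\phi=\mathcal P\setminus\mathcal C_\phi$. A point $P=\langle x,\psi\rangle$ exposes $A=\langle y,\psi\rangle$ (with $x,y>0$, same ray from the origin) if $x\ge y$. $[n]=\{0,\dots,n-1\}$. Problem $\mathcal D\text{-MSP}_n(c)$, for a search domain $\mathcal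 D\subseteq\mathbb R^2\setminus\{(0,0)\}$ and speeds $c=(c_0,\dots,c_{n-1})$: a feasible solution consists of continuous, piecewise differentiable curves $\tau_i:\mathbb R\to\mathbb R^2$, $i\in[n]$, with $\lim_{t\to-\infty}\tau_i(t)=(0,0)$, such that every $A\in\mathcal D$ is exposed by some point $\tau_i(t)$ of some curve. The parameter $t$ is not physical time: agent $i$ moves along $\tau_i$ at speed $c_i$, so it reaches $\tau_i(t)$ at time $\ell_i(t)/c_i$, where $\ell_i(t)=\int_{-\infty}^t\|\tau_i'(u)\|\,du$. If $t_A^i$ is the earliest parameter at which $\tau_i(t_A^i)$ exposes $A$ (infinite if none), the search cost of the solution is $\sup_{A\in\mathcal D}\frac1{\|A\|}\min_{i\in[n]}\frac{\ell_i(t_A^i)}{c_i}$. "Admits a solution with search cost $S$" means there is a feasible solution whose search cost equals $S$. *)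

theory Defs
  imports "HOL-Analysis.Analysis"
begin

definition kappa :: "nat \<Rightarrow> real" where
  "kappa i = (THE k. k > 0 \<and> k ^ 3 + k = real i / (2 * pi))"

definition cal_U :: "nat \<Rightarrow> real" where
  "cal_U i = sqrt (1 + (kappa i)\<^sup>2) / kappa i * exp (2 * pi * kappa i / real i)"

text \<open>The next two quantities are minima over open intervals, hence \<open>LEAST\<close> over the set of values.\<close>

definition cal_F :: "real \<Rightarrow> real" where
  "cal_F \<phi> = (LEAST v. \<exists>\<theta>\<in>{\<phi> <..< pi / 2 + \<phi> / 2}.
     v = (sin \<theta> / sin (\<theta> - \<phi>))\<^sup>2 * (1 / cos (\<theta> - \<phi> / 2)))"

definition k_fun :: "real \<Rightarrow> real \<Rightarrow> real" where
  "k_fun \<phi> l = ln l / (2 * pi)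
     + (l - 1) / sqrt (2 * l * (1 - cos \<phi>)) * (1 - \<phi> / (2 * pi))"

definition cal_R :: "real \<Rightarrow> real" where
  "cal_R \<phi> = (LEAST v. \<exists>l\<in>{1 <..}.
     v = sqrt (l\<^sup>2 - 2 * l * cos \<phi> + 1) / (l - 1) * exp (2 * pi * k_fun \<phi> l))"

definition gamma_fun :: "real \<Rightarrow> real" where
  "gamma_fun \<phi> = cos (\<phi> / 2) * cal_F \<phi> / cal_R \<phi>"

text \<open>The norm on \<open>real \<times> real\<close> is the Euclidean one.\<close>

type_synonym point = "real \<times> real"

definition polar :: "real \<Rightarrow> real \<Rightarrow> point" where
  "polar \<rho> \<omega> = \<rho> *\<^sub>R (cos \<omega>, sin \<omega>)"

definition ray :: "real \<Rightarrow> point set" where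
  "ray \<psi> = {polar x \<psi> | x. x > 0}"

definition plane :: "point set" where
  "plane = UNIV - {(0, 0)}"

definition plane_cone :: "real \<Rightarrow> point set" where
  "plane_cone \<phi> = (\<Union>\<psi>\<in>{0..<\<phi>}. ray \<psi>)"

definition conic_complement :: "real \<Rightarrow> point set" where
  "conic_complement \<phi> = plane - plane_cone \<phi>"

definition exposes :: "point \<Rightarrow> point \<Rightarrow> bool" where
  "exposes P A \<longleftrightarrow> (\<exists>x y \<psi>. x > 0 \<and> y > 0 \<and> P = polar x \<psi> \<and> A = polar y \<psi> \<and> x \<ge> y)"

text \<open>Piecewise differentiability is imposed on every compact interval, so the breakpoints
  are locally finite but may accumulate at \<open>-\<infinity>\<close> and \<open>\<infinity>\<close> (as in a zigzag that leaves the origin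
  through infinitely many turns); on all of \<open>\<real>\<close> the library predicate would only allow
  finitely many.\<close>

definition search_curve :: "(real \<Rightarrow> point) \<Rightarrow> bool" where
  "search_curve \<tau> \<longleftrightarrow> continuous_on UNIV \<tau>
     \<and> (\<forall>a b. \<tau> piecewise_differentiable_on {a..b})
     \<and> (\<tau> \<longlongrightarrow> (0, 0)) at_bot"

definition feasible :: "point set \<Rightarrow> nat \<Rightarrow> (nat \<Rightarrow> real \<Rightarrow> point) \<Rightarrow> bool" where
  "feasible D n \<tau> \<longleftrightarrow> (\<forall>i<n. search_curve (\<tau> i)) \<and> (\<forall>A\<in>D. \<exists>i<n. \<exists>t. exposes (\<tau> i t) A)"

definition path_len :: "(real \<Rightarrow> point) \<Rightarrow> real \<Rightarrow> ennreal" where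
  "path_len \<tau> t = (\<integral>\<^sup>+u\<in>{..t}. ennreal (norm (vector_derivative \<tau> (at u))) \<partial>lborel)"

text \<open>For a search curve the set of parameters exposing \<open>A\<close> is closed and bounded below,
  so when it is nonempty the \<open>LEAST\<close> is attained. A curve that never exposes \<open>A\<close> contributes \<open>\<infinity>\<close>,
  even if its total length is finite.\<close>

definition exposure_len :: "(real \<Rightarrow> point) \<Rightarrow> point \<Rightarrow> ennreal" where
  "exposure_len \<tau> A =
     (if \<exists>t. exposes (\<tau> t) A then path_len \<tau> (LEAST t. exposes (\<tau> t) A) else \<infinity>)"

text \<open>The number of agents is the length of the list of speeds.\<close>

definition search_cost :: "point set \<Rightarrow> real list \<Rightarrow> (nat \<Rightarrow> real \<Rightarrow> point) \<Rightarrow> ennreal" where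
  "search_cost D cs \<tau> = (SUP A\<in>D.
     (INF i\<in>{..<length cs}. exposure_len (\<tau> i) A / ennreal (cs ! i)) / ennreal (norm A))"

definition solution_with_cost ::
    "point set \<Rightarrow> real list \<Rightarrow> (nat \<Rightarrow> real \<Rightarrow> point) \<Rightarrow> real \<Rightarrow> bool" where
  "solution_with_cost D cs \<tau> S \<longleftrightarrow>
     feasible D (length cs) \<tau> \<and> search_cost D cs \<tau> = ennreal S"

end

theory Submission
  imports Defs
begin

text \<open>
  A single logarithmic spiral of exponent \<open>\<kappa>\<^sub>1\<close> has cost \<open>U\<^sub>1\<close> while the slow agent stays at the origin,
  and two spirals of exponent \<open>\<kappa>\<^sub>2\<close> have cost \<open>U\<^sub>2 / sqrt c\<close> if their shift makes the worst delays of both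
  agents agree.

  In the intermediate range the fast agent follows a spiral of exponent \<open>s\<close> in \<open>W\<^sub>\<phi>\<close> and crosses the cone
  along a chord. For the right jump factor its length is \<open>sqrt (1 + s\<^sup>2) / s\<close> times the radius at both
  ends of the chord, so its cost on every ray of \<open>W\<^sub>\<phi>\<close> is this factor times the growth per turn, which is
  the objective of \<open>R\<^sub>\<phi>\<close>. The slow agent zigzags between the boundary rays of the cone. At the turning
  points its length is proportional to the radius, and its cost on the boundary rays is
  \<open>cos (\<phi> / 2)\<close> times the objective of \<open>F\<^sub>\<phi>\<close>, which is \<open>c R\<^sub>\<phi>\<close> when \<open>\<gamma>(\<phi>) = c\<close>. Such a \<open>\<phi>\<close> exists because \<open>\<gamma>\<close> is
  continuous, tends to \<open>1 / U\<^sub>1 < 0.0578391\<close> as \<open>\<phi> \<rightarrow> 0\<close>, and is at least \<open>0.268872\<close> when \<open>tan (\<phi> / 2) = 0.42\<close>.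
  The total cost is not below \<open>R\<^sub>\<phi>\<close> because the slow agent never visits the ray of angle \<open>\<pi>\<close>.
\<close>

section \<open>Exposure and search cost\<close>

text \<open>The costs are suprema that are not attained: just beyond a point where a curve crosses a
  ray, exposure has to wait for a later crossing. Upper bounds therefore hold at every point, while
  sharpness is shown along points at distance x * r with x > 1 on one fixed ray, letting x tend to
  1. Both minima are encoded by \<open>LEAST\<close>, which says nothing before attainment is
  proved. Coercivity supplies it by confining minimisers to a compact set; choosing this set
  uniformly in the angle also yields the continuity needed for the intermediate value theorem. The
  delicate point of the cone strategy is the interior of the cone. The equation for gamma only
  balances the cost on the boundary rays; that inner rays are no worse is a separate inequality,
  which fails for wide cones. So the intermediate value argument is confined to tan (\<phi> / 2)
  \<le> 0.42: large enough for gamma to pass 0.268872, small enough for that inequality and for the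
  compactness bounds on F.\<close>

lemma norm_polar [simp]: "norm (polar \<rho> \<omega>) = \<bar>\<rho>\<bar>"
proof -
  have "norm (cos \<omega>, sin \<omega>) = 1"
    by (simp add: norm_Pair)
  then show ?thesis
    unfolding polar_def norm_scaleR by simp
qed

lemma polar_shift [simp]: "polar \<rho> (\<omega> + 2 * pi * of_int j) = polar \<rho> \<omega>"
  by (simp add: polar_def sin_add cos_add)

lemma polar_eq_polar_iff:
  assumes "x > 0" "y > 0"
  shows "polar x \<omega> = polar y \<psi> \<longleftrightarrow> x = y \<and> (\<exists>j::int. \<omega> = \<psi> + 2 * pi * of_int j)"
proof
  assume eq: "polar x \<omega> = polar y \<psi>"
  then have "norm (polar x \<omega>) = norm (polar y \<psi>)"
    by simp
  then have xy: "x = y"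
    using assms by simp
  then have "cos \<omega> = cos \<psi>" "sin \<omega> = sin \<psi>"
    using eq assms by (auto simp: polar_def)
  then obtain j :: int where "\<omega> = \<psi> + 2 * of_int j * pi"
    using sin_cos_eq_iff[of \<omega> \<psi>] by auto
  then show "x = y \<and> (\<exists>j::int. \<omega> = \<psi> + 2 * pi * of_int j)"
    using xy by (auto simp: mult_ac)
qed auto

lemma exposes_polar_iff:
  assumes "y > 0"
  shows "exposes P (polar y \<psi>) \<longleftrightarrow> (\<exists>x\<ge>y. P = polar x \<psi>)"
proof
  assume "exposes P (polar y \<psi>)"
  then obtain x y' \<psi>' where *: "x > 0" "y' > 0" "P = polar x \<psi>'" "polar y \<psi> = polar y' \<psi>'" "x \<ge> y'"
    by (auto simp: exposes_def)
  then obtain j :: int where "y = y'" "\<psi> = \<psi>' + 2 * pi * of_int j"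
    using polar_eq_polar_iff assms by metis
  then show "\<exists>x\<ge>y. P = polar x \<psi>"
    using * by auto
next
  assume "\<exists>x\<ge>y. P = polar x \<psi>"
  then show "exposes P (polar y \<psi>)"
    unfolding exposes_def using assms by (metis less_le_trans)
qed

lemma exposes_polar_polar_iff:
  assumes "x > 0" "y > 0"
  shows "exposes (polar x \<omega>) (polar y \<psi>) \<longleftrightarrow> y \<le> x \<and> (\<exists>j::int. \<omega> = \<psi> + 2 * pi * of_int j)"
  using assms by (auto simp: exposes_polar_iff polar_eq_polar_iff)

lemma exposesE:
  assumes "exposes P A"
  obtains y \<psi> where "y > 0" "A = polar y \<psi>"
  using assms by (auto simp: exposes_def)

lemma plane_polarE:
  assumes "A \<in> plane"
  obtains y \<psi> where "y > 0" "0 \<le> \<psi>" "\<psi> < 2 * pi" "A = polar y \<psi>"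
proof -
  obtain a b where A: "A = (a, b)" "(a, b) \<noteq> (0, 0)"
    using assms by (cases A) (auto simp: plane_def)
  define r where "r = sqrt (a\<^sup>2 + b\<^sup>2)"
  have r: "r > 0"
    using A(2) unfolding r_def real_sqrt_gt_0_iff sum_power2_gt_zero_iff by simp
  have "r\<^sup>2 = a\<^sup>2 + b\<^sup>2"
    by (simp add: r_def)
  then have "(a / r)\<^sup>2 + (b / r)\<^sup>2 = r\<^sup>2 / r\<^sup>2"
    by (simp only: power_divide add_divide_distrib)
  then have "(a / r)\<^sup>2 + (b / r)\<^sup>2 = 1"
    using r by simp
  then obtain \<psi> where "0 \<le> \<psi>" "\<psi> < 2 * pi" "a / r = cos \<psi>" "b / r = sin \<psi>"
    using sincos_total_2pi by metis
  then show ?thesis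
    using that[of r \<psi>] A r by (auto simp: polar_def field_simps)
qed

lemma polar_in_plane: "y > 0 \<Longrightarrow> polar y \<psi> \<in> plane"
  using norm_polar[of y \<psi>] by (auto simp: plane_def norm_Pair simp del: norm_polar)

text \<open>The exposing points form the part of a closed ray at distance at least
  \<open>norm A\<close> from the origin. The equation \<open>P = polar (norm P) \<psi>\<close>
  describes that ray including the origin, so both conditions are closed.\<close>

lemma closed_exposes: "closed {P. exposes P A}"
proof (cases "\<exists>P. exposes P A")
  case True
  then obtain y \<psi> where y: "y > 0" and A: "A = polar y \<psi>"
    by (auto elim: exposesE)
  have "{P. exposes P A} = {P. P = polar (norm P) \<psi>} \<inter> {P. y \<le> norm P}"
    using y by (auto simp: A exposes_polar_iff)
  moreover have "closed {P. P = polar (norm P) \<psi>}"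
    unfolding polar_def by (intro closed_Collect_eq continuous_intros)
  moreover have "closed {P :: point. y \<le> norm P}"
    by (intro closed_Collect_le continuous_intros)
  ultimately show ?thesis
    by (metis closed_Int)
next
  case False
  then show ?thesis
    by (metis (no_types, lifting) closed_empty empty_Collect_eq)
qed

text \<open>Closedness passes to the set of parameters by continuity. The set is bounded below
  because the curve tends to the origin at -infinity, so early points are too close to the origin to
  expose A. Hence the infimum is attained and is the value of \<open>LEAST\<close>.\<close>

lemma exposes_Least:
  assumes "search_curve \<tau>" and "exposes (\<tau> t) A"
  defines "m \<equiv> LEAST t. exposes (\<tau> t) A"
  shows "exposes (\<tau> m) A" and "m \<le> t"
proof -
  obtain y \<psi> where y: "y > 0" and A: "A = polar y \<psi>"
    using assms(2) by (rule exposesE)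
  have cont: "continuous_on UNIV \<tau>" and lim: "(\<tau> \<longlongrightarrow> (0, 0)) at_bot"
    using assms(1) by (auto simp: search_curve_def)
  let ?S = "{t. exposes (\<tau> t) A}"
  have closed: "closed ?S"
    using continuous_closed_preimage[OF cont closed_UNIV closed_exposes[of A]] by (simp add: vimage_def)
  have "((\<lambda>t. norm (\<tau> t)) \<longlongrightarrow> 0) at_bot"
    using tendsto_norm[OF lim] by (simp add: norm_Pair)
  then have "eventually (\<lambda>t. norm (\<tau> t) < y) at_bot"
    using y by (rule order_tendstoD)
  then obtain B where B: "\<And>t. t \<le> B \<Longrightarrow> norm (\<tau> t) < y"
    by (auto simp: eventually_at_bot_linorder)
  have "y \<le> norm (\<tau> t)" if "t \<in> ?S" for t
    using that y by (auto simp: A exposes_polar_iff)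
  then have bdd: "bdd_below ?S"
    using B by (intro bdd_belowI[of _ B]) (metis linorder_not_le nle_le)
  have Inf: "Inf ?S \<in> ?S"
    using assms(2) closed bdd by (intro closed_contains_Inf) auto
  have le: "Inf ?S \<le> s" if "s \<in> ?S" for s
    using bdd that by (rule cInf_lower[rotated])
  have "m = Inf ?S"
    unfolding m_def using Inf le by (intro Least_equality) auto
  then show "exposes (\<tau> m) A" "m \<le> t"
    using Inf le assms(2) by auto
qed

lemma path_len_mono: "s \<le> t \<Longrightarrow> path_len \<tau> s \<le> path_len \<tau> t"
  unfolding path_len_def by (intro nn_integral_mono) (auto simp: indicator_def)

lemma exposure_len_le:
  assumes "search_curve \<tau>" "exposes (\<tau> t) A"
  shows "exposure_len \<tau> A \<le> path_len \<tau> t"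
  using exposes_Least(2)[OF assms] assms(2) by (auto simp: exposure_len_def intro: path_len_mono)

lemma exposure_len_ge:
  assumes "search_curve \<tau>" "\<And>t. exposes (\<tau> t) A \<Longrightarrow> L \<le> path_len \<tau> t"
  shows "L \<le> exposure_len \<tau> A"
proof (cases "\<exists>t. exposes (\<tau> t) A")
  case True
  then show ?thesis
    using exposes_Least(1)[OF assms(1)] assms(2) by (metis exposure_len_def)
qed (simp add: exposure_len_def)

lemma search_cost_le:
  assumes "0 \<le> S"
    and exposed: "\<And>A. A \<in> D \<Longrightarrow> \<exists>i<length cs. search_curve (\<tau> i) \<and> 0 < cs ! i \<and>
      (\<exists>t. exposes (\<tau> i t) A \<and> path_len (\<tau> i) t \<le> ennreal (S * cs ! i * norm A))"
  shows "search_cost D cs \<tau> \<le> ennreal S"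
  unfolding search_cost_def
proof (rule SUP_least)
  fix A assume "A \<in> D"
  from exposed[OF this] obtain i t where i: "i < length cs" "search_curve (\<tau> i)" "0 < cs ! i"
    and t: "exposes (\<tau> i t) A" "path_len (\<tau> i) t \<le> ennreal (S * cs ! i * norm A)"
    by blast
  have A: "norm A > 0"
    using t(1) by (metis abs_of_pos exposesE norm_polar)
  have "exposure_len (\<tau> i) A / ennreal (cs ! i) \<le> ennreal (S * cs ! i * norm A) / ennreal (cs ! i)"
    using exposure_len_le[OF i(2) t(1)] t(2) by (intro divide_right_mono_ennreal) auto
  also have "\<dots> = ennreal (S * norm A)"
    using i A assms(1) by (simp add: divide_ennreal)
  finally have "(INF i\<in>{..<length cs}. exposure_len (\<tau> i) A / ennreal (cs ! i)) \<le> ennreal (S * norm A)"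
    using i(1) by (intro INF_lower2[of i]) auto
  then have "(INF i\<in>{..<length cs}. exposure_len (\<tau> i) A / ennreal (cs ! i)) / ennreal (norm A)
      \<le> ennreal (S * norm A) / ennreal (norm A)"
    by (rule divide_right_mono_ennreal)
  also have "\<dots> = ennreal S"
    using A assms(1) by (simp add: divide_ennreal)
  finally show "(INF i\<in>{..<length cs}. exposure_len (\<tau> i) A / ennreal (cs ! i)) / ennreal (norm A) \<le> ennreal S" .
qed

lemma ennreal_le_of_scaled:
  assumes "0 \<le> S" and "\<And>x. 1 < x \<Longrightarrow> ennreal (S / x) \<le> X"
  shows "ennreal S \<le> X"
proof (rule tendsto_upperbound[where F = "at_right 1"])
  have "((\<lambda>x. S / x) \<longlongrightarrow> S / 1) (at_right 1)"
    by (intro tendsto_intros) auto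
  then show "((\<lambda>x. ennreal (S / x)) \<longlongrightarrow> ennreal S) (at_right 1)"
    by (intro tendsto_ennrealI) simp
  show "eventually (\<lambda>x. ennreal (S / x) \<le> X) (at_right 1)"
    using assms(2) by (auto simp: eventually_at_filter)
qed auto

text \<open>The cost at a point at distance x * r is at least S / x, and x may tend to 1. The strict
  inequality matters: in the applications a curve crosses the ray at distance r itself, so only
  points beyond r have to wait for a later crossing.\<close>

lemma search_cost_ge:
  assumes "0 \<le> S" "0 < r"
    and curves: "\<And>i. i < length cs \<Longrightarrow> search_curve (\<tau> i) \<and> 0 < cs ! i"
    and pt: "\<And>x. 1 < x \<Longrightarrow> \<exists>A\<in>D. norm A = x * r \<and>
      (\<forall>i<length cs. \<forall>t. exposes (\<tau> i t) A \<longrightarrow> ennreal (S * cs ! i * r) \<le> path_len (\<tau> i) t)"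
  shows "ennreal S \<le> search_cost D cs \<tau>"
proof (rule ennreal_le_of_scaled[OF assms(1)])
  fix x :: real assume x: "1 < x"
  from pt[OF this] obtain A where A: "A \<in> D" "norm A = x * r"
    and late: "\<And>i t. i < length cs \<Longrightarrow> exposes (\<tau> i t) A \<Longrightarrow> ennreal (S * cs ! i * r) \<le> path_len (\<tau> i) t"
    by auto
  have "ennreal (S * r) \<le> exposure_len (\<tau> i) A / ennreal (cs ! i)" if "i < length cs" for i
  proof -
    have "ennreal (S * r) = ennreal (S * cs ! i * r) / ennreal (cs ! i)"
      using curves[OF that] assms by (simp add: divide_ennreal)
    also have "\<dots> \<le> exposure_len (\<tau> i) A / ennreal (cs ! i)"
      using curves[OF that] late[OF that] by (intro divide_right_mono_ennreal exposure_len_ge) auto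
    finally show ?thesis .
  qed
  then have "ennreal (S * r) \<le> (INF i\<in>{..<length cs}. exposure_len (\<tau> i) A / ennreal (cs ! i))"
    by (intro INF_greatest) auto
  then have "ennreal (S * r) / ennreal (norm A)
      \<le> (INF i\<in>{..<length cs}. exposure_len (\<tau> i) A / ennreal (cs ! i)) / ennreal (norm A)"
    by (rule divide_right_mono_ennreal)
  also have "\<dots> \<le> search_cost D cs \<tau>"
    unfolding search_cost_def using A(1) by (intro SUP_upper)
  finally show "ennreal (S / x) \<le> search_cost D cs \<tau>"
    using A x assms by (simp add: divide_ennreal)
qed

section \<open>Lengths of piecewise smooth curves\<close>

text \<open>The fundamental theorem of calculus applies on compact intervals, which contain only
  finitely many breakpoints. Monotone convergence over the intervals [t - n, t] and the limit of l
  at -infinity then give the half-line.\<close>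

lemma path_len_eq:
  fixes l :: "real \<Rightarrow> real"
  assumes N: "\<And>a b. finite (N \<inter> {a..b})"
    and deriv: "\<And>u. u \<notin> N \<Longrightarrow> (\<tau> has_vector_derivative D u) (at u)"
    and speed: "\<And>u. u \<notin> N \<Longrightarrow> (l has_real_derivative norm (D u)) (at u)"
    and cont: "continuous_on UNIV l"
    and lim: "(l \<longlongrightarrow> 0) at_bot"
  shows "path_len \<tau> t = ennreal (l t)"
proof -
  define v where "v u = (if u \<in> N then 0 else norm (D u))" for u
  have "N = (\<Union>n::nat. N \<inter> {- real n..real n})"
  proof -
    have "\<exists>n::nat. - real n \<le> x \<and> x \<le> real n" for x
    proof -
      obtain n where "\<bar>x\<bar> \<le> real n"
        using real_arch_simple by blast
      then show ?thesis
        by (intro exI[of _ n]) linarith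
    qed
    then show ?thesis
      by auto
  qed
  moreover have "countable (\<Union>n::nat. N \<inter> {- real n..real n})"
    by (rule countable_UN) (simp_all add: countable_finite N)
  ultimately have countable: "countable N"
    by (rule ssubst)
  then have N_borel: "N \<in> sets borel"
    by (rule sets.countable[rotated]) auto
  have l_borel: "l \<in> borel_measurable borel"
    using cont by (rule borel_measurable_continuous_onI)
  \<comment> \<open>The speed is not assumed to be measurable. Off the countable set N it is the
    limit of difference quotients of the continuous function l, and the indicator removes N.\<close>
  have v_borel [measurable]: "v \<in> borel_measurable borel"
  proof (rule borel_measurable_LIMSEQ_real)
    fix u :: real
    show "(\<lambda>n. indicator (- N) u * (real (Suc n) * (l (u + 1 / real (Suc n)) - l u))) \<longlonglongrightarrow> v u"
    proof (cases "u \<in> N")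
      case False
      have "((\<lambda>h. (l (u + h) - l u) / h) \<longlongrightarrow> norm (D u)) (at 0)"
        using speed[OF False] by (simp add: DERIV_def)
      moreover have "filterlim (\<lambda>n. 1 / real (Suc n)) (at 0) sequentially"
        using LIMSEQ_Suc[OF lim_1_over_n] by (auto simp: filterlim_at)
      ultimately have "(\<lambda>n. (l (u + 1 / real (Suc n)) - l u) / (1 / real (Suc n))) \<longlonglongrightarrow> norm (D u)"
        by (rule filterlim_compose)
      then show ?thesis
        using False by (simp add: v_def mult.commute)
    qed (simp add: v_def)
  next
    fix n :: nat
    show "(\<lambda>u. indicator (- N) u * (real (Suc n) * (l (u + 1 / real (Suc n)) - l u))) \<in> borel_measurable borel"
      using N_borel l_borel
      by (intro borel_measurable_times borel_measurable_indicator borel_measurable_const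
        borel_measurable_diff measurable_compose[OF _ l_borel] borel_measurable_add) auto
  qed
  have v0: "0 \<le> v u" for u
    by (simp add: v_def)
  have int: "(v has_integral (l b - l a)) {a..b}" if "a \<le> b" for a b
  proof (rule fundamental_theorem_of_calculus_interior_strong[of "N \<inter> {a..b}"])
    show "(l has_vector_derivative v x) (at x)" if "x \<in> {a<..<b} - N \<inter> {a..b}" for x
      using that speed[of x] by (auto simp: v_def has_real_derivative_iff_has_vector_derivative)
    show "continuous_on {a..b} l"
      using cont continuous_on_subset by blast
  qed (use N that in auto)
  have Icc: "(\<integral>\<^sup>+u. ennreal (v u) * indicator {a..b} u \<partial>lborel) = ennreal (l b - l a)" if "a \<le> b" for a b
    using nn_integral_has_integral_lebesgue[OF _ int[OF that]] v0
    by (simp add: nn_integral_completion mult.commute ennreal_indicator ennreal_mult)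
  have "(\<integral>\<^sup>+u. ennreal (v u) * indicator {..t} u \<partial>lborel) =
      (SUP n. \<integral>\<^sup>+u. ennreal (v u) * indicator {t - real n..t} u \<partial>lborel)"
  proof -
    have "(SUP n. ennreal (v u) * indicator {t - real n..t} u) = ennreal (v u) * indicator {..t} u" for u
    proof (rule antisym)
      obtain n where "t - u \<le> real n"
        using real_arch_simple by blast
      then show "ennreal (v u) * indicator {..t} u \<le> (SUP n. ennreal (v u) * indicator {t - real n..t} u)"
        by (intro SUP_upper2[of n]) (auto simp: indicator_def)
    qed (auto intro!: SUP_least simp: indicator_def)
    moreover have "incseq (\<lambda>n u. ennreal (v u) * indicator {t - real n..t} u)"
      by (auto simp: incseq_def le_fun_def indicator_def)
    ultimately show ?thesis
      using nn_integral_monotone_convergence_SUP[of "\<lambda>n u. ennreal (v u) * indicator {t - real n..t} u" lborel]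
      by simp
  qed
  also have "\<dots> = (SUP n. ennreal (l t - l (t - real n)))"
    by (simp add: Icc)
  also have "\<dots> = ennreal (l t)"
  proof (rule LIMSEQ_unique[OF LIMSEQ_SUP])
    have "l (t - real n) \<le> l (t - real m)" if "m \<le> n" for m n
      using has_integral_nonneg[OF int[of "t - real n" "t - real m"]] v0 that by auto
    then show "incseq (\<lambda>n. ennreal (l t - l (t - real n)))"
      by (auto simp: incseq_def intro!: ennreal_leI)
    have "filterlim (\<lambda>n. t - real n) at_bot sequentially"
      unfolding filterlim_uminus_at_bot
      using filterlim_tendsto_add_at_top[OF tendsto_const filterlim_real_sequentially, of "- t"]
      by simp
    then have "(\<lambda>n. l (t - real n)) \<longlonglongrightarrow> 0"
      using lim by (rule filterlim_compose[rotated])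
    then have "(\<lambda>n. l t - l (t - real n)) \<longlonglongrightarrow> l t - 0"
      by (intro tendsto_intros)
    then show "(\<lambda>n. ennreal (l t - l (t - real n))) \<longlonglongrightarrow> ennreal (l t)"
      by (intro tendsto_ennrealI) simp
  qed
  \<comment> \<open>At points of N \<open>vector_derivative\<close> may be an arbitrary value; N is
    countable, hence a null set, so the integral does not change.\<close>
  also have "(\<integral>\<^sup>+u. ennreal (v u) * indicator {..t} u \<partial>lborel) = path_len \<tau> t"
    unfolding path_len_def
  proof (rule nn_integral_cong_AE)
    have "AE u in lborel. u \<notin> N"
      using countable by (intro AE_not_in countable_imp_null_set_lborel)
    then show "AE u in lborel. ennreal (v u) * indicator {..t} u =
        ennreal (norm (vector_derivative \<tau> (at u))) * indicator {..t} u"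
      by (rule AE_mp) (auto simp: v_def vector_derivative_at[OF deriv])
  qed
  finally show ?thesis .
qed

text \<open>Turns the \<open>ennreal\<close>-valued length into an explicit real function, so that
  later estimates are real arithmetic.\<close>

definition arc_length :: "(real \<Rightarrow> point) \<Rightarrow> (real \<Rightarrow> real) \<Rightarrow> bool" where
  "arc_length \<tau> l \<longleftrightarrow> search_curve \<tau> \<and> (\<forall>t. path_len \<tau> t = ennreal (l t))"

lemma arc_lengthI:
  assumes N: "\<And>a b. finite (N \<inter> {a..b})"
    and deriv: "\<And>u. u \<notin> N \<Longrightarrow> (\<tau> has_vector_derivative D u) (at u)"
    and speed: "\<And>u. u \<notin> N \<Longrightarrow> (l has_real_derivative norm (D u)) (at u)"
    and cont: "continuous_on UNIV \<tau>" "continuous_on UNIV l"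
    and lim: "(\<tau> \<longlongrightarrow> 0) at_bot" "(l \<longlongrightarrow> 0) at_bot"
  shows "arc_length \<tau> l"
proof -
  have "\<tau> piecewise_differentiable_on {a..b}" for a b
    unfolding piecewise_differentiable_on_def
  proof (intro conjI exI ballI)
    show "continuous_on {a..b} \<tau>"
      using cont(1) continuous_on_subset by blast
    show "finite (N \<inter> {a..b})"
      by (rule N)
    show "\<tau> differentiable at x within {a..b}" if "x \<in> {a..b} - N \<inter> {a..b}" for x
      using deriv[of x] that
      by (auto intro: differentiable_at_withinI differentiableI_vector)
  qed
  then show ?thesis
    using cont(1) lim(1) path_len_eq[OF N deriv speed cont(2) lim(2)]
    by (auto simp: arc_length_def search_curve_def zero_prod_def)
qed

section \<open>Logarithmic spirals\<close>

lemma has_vector_derivative_polar: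
  assumes "(\<rho> has_real_derivative \<rho>') (at t)" "(\<theta> has_real_derivative \<theta>') (at t)"
  shows "((\<lambda>t. polar (\<rho> t) (\<theta> t)) has_vector_derivative
    (\<rho>' * cos (\<theta> t) - \<rho> t * \<theta>' * sin (\<theta> t), \<rho>' * sin (\<theta> t) + \<rho> t * \<theta>' * cos (\<theta> t))) (at t)"
proof -
  have "((\<lambda>t. \<rho> t * cos (\<theta> t)) has_real_derivative \<rho>' * cos (\<theta> t) - \<rho> t * \<theta>' * sin (\<theta> t)) (at t)"
    "((\<lambda>t. \<rho> t * sin (\<theta> t)) has_real_derivative \<rho>' * sin (\<theta> t) + \<rho> t * \<theta>' * cos (\<theta> t)) (at t)"
    by (auto intro!: derivative_eq_intros assms simp: algebra_simps)
  then show ?thesis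
    by (auto simp: polar_def has_real_derivative_iff_has_vector_derivative
      intro!: has_vector_derivative_Pair)
qed

text \<open>The spiral meets all rays at the same angle, so its speed is sqrt (1 + k^2) / k times
  the growth rate of its radius, and its length from the origin is this multiple of the radius. The
  factor w lets an arc of angle w be run through on [0, 1].\<close>

lemma spiral_derivative:
  fixes a k \<beta> w t :: real
  defines "D \<equiv> (let r = a * exp (k * (w * t)); \<theta> = w * t + \<beta> in
      (r * (k * w) * cos \<theta> - r * w * sin \<theta>, r * (k * w) * sin \<theta> + r * w * cos \<theta>))"
  assumes "0 < a" "0 < k" "0 < w"
  shows "((\<lambda>t. polar (a * exp (k * (w * t))) (w * t + \<beta>)) has_vector_derivative D) (at t)"
    and "((\<lambda>t. sqrt (1 + k\<^sup>2) / k * (a * exp (k * (w * t)))) has_real_derivative norm D) (at t)"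
proof -
  show "((\<lambda>t. polar (a * exp (k * (w * t))) (w * t + \<beta>)) has_vector_derivative D) (at t)"
  proof -
    have "((\<lambda>t. a * exp (k * (w * t))) has_real_derivative a * exp (k * (w * t)) * (k * w)) (at t)"
      "((\<lambda>t. w * t + \<beta>) has_real_derivative w) (at t)"
      by (auto intro!: derivative_eq_intros)
    from has_vector_derivative_polar[OF this] show ?thesis
      by (simp only: D_def Let_def)
  qed
  define r where "r = a * exp (k * (w * t))"
  define \<theta> where "\<theta> = w * t + \<beta>"
  have r: "r > 0"
    using assms by (simp add: r_def)
  have "(r * (k * w) * cos \<theta> - r * w * sin \<theta>)\<^sup>2 + (r * (k * w) * sin \<theta> + r * w * cos \<theta>)\<^sup>2
    = (r * w)\<^sup>2 * (1 + k\<^sup>2) * ((sin \<theta>)\<^sup>2 + (cos \<theta>)\<^sup>2)"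
    by algebra
  then have "norm D = r * w * sqrt (1 + k\<^sup>2)"
    using r assms(4) by (simp add: D_def norm_Pair r_def[symmetric] \<theta>_def[symmetric] real_sqrt_mult)
  moreover have "((\<lambda>t. sqrt (1 + k\<^sup>2) / k * (a * exp (k * (w * t)))) has_real_derivative
      sqrt (1 + k\<^sup>2) / k * (r * (k * w))) (at t)"
    unfolding r_def by (auto intro!: derivative_eq_intros)
  ultimately show "((\<lambda>t. sqrt (1 + k\<^sup>2) / k * (a * exp (k * (w * t)))) has_real_derivative norm D) (at t)"
    using assms(3) by (simp add: mult_ac)
qed

lemma exp_times_at_bot:
  fixes k :: real
  assumes "0 < k"
  shows "((\<lambda>t. exp (k * t)) \<longlongrightarrow> 0) at_bot"
  by (rule filterlim_compose[OF exp_at_bot])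
    (rule filterlim_tendsto_pos_mult_at_bot[OF tendsto_const assms filterlim_ident])

lemma arc_length_spiral:
  assumes "0 < a" "0 < k"
  shows "arc_length (\<lambda>t. polar (a * exp (k * t)) (t + \<beta>)) (\<lambda>t. sqrt (1 + k\<^sup>2) / k * (a * exp (k * t)))"
proof (rule arc_lengthI[where N = "{}"])
  have lim: "((\<lambda>t. C * (a * exp (k * t))) \<longlongrightarrow> 0) at_bot" for C
    using tendsto_mult_left[OF exp_times_at_bot[OF assms(2)], of "C * a"] by (simp add: mult.assoc)
  then show "((\<lambda>t. sqrt (1 + k\<^sup>2) / k * (a * exp (k * t))) \<longlongrightarrow> 0) at_bot" .
  show "((\<lambda>t. polar (a * exp (k * t)) (t + \<beta>)) \<longlongrightarrow> 0) at_bot"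
    by (rule tendsto_norm_zero_cancel) (use lim[of 1] assms in simp)
  show "continuous_on UNIV (\<lambda>t. polar (a * exp (k * t)) (t + \<beta>))"
    unfolding polar_def by (intro continuous_intros)
  show "continuous_on UNIV (\<lambda>t. sqrt (1 + k\<^sup>2) / k * (a * exp (k * t)))"
    by (intro continuous_intros)
qed (use spiral_derivative[OF assms zero_less_one, where \<beta> = \<beta>] in simp_all)

text \<open>The curve that runs through \<open>g\<close> on \<open>[0, 1]\<close> and is continued so that \<open>\<tau> (t + 1) = \<Lambda> \<tau> t\<close>.\<close>

definition self_similar :: "real \<Rightarrow> (real \<Rightarrow> 'a::real_normed_vector) \<Rightarrow> real \<Rightarrow> 'a" where
  "self_similar \<Lambda> g t = \<Lambda> powi \<lfloor>t\<rfloor> *\<^sub>R g (frac t)"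

text \<open>At u = 1 the floor already belongs to the next cell; the joining condition makes the two
  formulas agree there. So the formula holds on closed cells, which is what gluing requires.\<close>

lemma self_similar_cell:
  assumes "\<Lambda> \<noteq> 0" "g 1 = \<Lambda> *\<^sub>R g 0" "0 \<le> u" "u \<le> 1"
  shows "self_similar \<Lambda> g (of_int n + u) = \<Lambda> powi n *\<^sub>R g u"
proof (cases "u = 1")
  case True
  then have "self_similar \<Lambda> g (of_int n + u) = \<Lambda> powi (n + 1) *\<^sub>R g 0"
    using frac_of_int[of "n + 1", where 'a = real] by (simp add: self_similar_def)
  then show ?thesis
    using assms True by (simp add: power_int_add)
next
  case False
  then have "\<lfloor>of_int n + u\<rfloor> = n" "frac (of_int n + u) = u"
    using assms by (simp_all add: floor_eq_iff frac_def)
  then show ?thesis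
    by (simp add: self_similar_def)
qed

lemma self_similar_cell':
  assumes "\<Lambda> \<noteq> 0" "g 1 = \<Lambda> *\<^sub>R g 0" "t \<in> {of_int n..of_int n + 1}"
  shows "self_similar \<Lambda> g t = \<Lambda> powi n *\<^sub>R g (t - of_int n)"
  using self_similar_cell[OF assms(1,2), of "t - of_int n" n] assms(3) by simp

lemma continuous_self_similar:
  fixes g :: "real \<Rightarrow> 'a::real_normed_vector"
  assumes "\<Lambda> \<noteq> 0" "g 1 = \<Lambda> *\<^sub>R g 0" "continuous_on {0..1} g"
  shows "continuous_on UNIV (self_similar \<Lambda> g)"
proof -
  have cell: "continuous_on {of_int n..of_int n + 1} (self_similar \<Lambda> g)" for n
  proof -
    have "continuous_on {of_int n..of_int n + 1} (\<lambda>t. \<Lambda> powi n *\<^sub>R g (t - of_int n))"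
      by (intro continuous_intros continuous_on_compose2[OF assms(3)]) auto
    then show ?thesis
      by (rule continuous_on_eq) (simp add: self_similar_cell'[OF assms(1,2)])
  qed
  have "isCont (self_similar \<Lambda> g) t" for t
  proof -
    \<comment> \<open>Two adjacent cells are taken because t may be an integer; their union is a
      neighbourhood of t.\<close>
    define n where "n = \<lfloor>t\<rfloor>"
    have "continuous_on ({of_int (n - 1)..of_int (n - 1) + 1} \<union> {of_int n..of_int n + 1}) (self_similar \<Lambda> g)"
      by (intro continuous_on_closed_Un cell) auto
    also have "{of_int (n - 1)..of_int (n - 1) + 1} \<union> {of_int n..of_int n + 1} = {of_int n - 1..of_int n + 1 :: real}"
      by auto
    finally show ?thesis
      by (rule continuous_on_interior) (use n_def in \<open>simp add: interior_atLeastAtMost_real, linarith\<close>)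
  qed
  then show ?thesis
    by (simp add: continuous_on_eq_continuous_at)
qed

lemma self_similar_at_bot:
  fixes g :: "real \<Rightarrow> 'a::real_normed_vector"
  assumes "1 < \<Lambda>" "continuous_on {0..1} g"
  shows "(self_similar \<Lambda> g \<longlongrightarrow> 0) at_bot"
proof -
  have "compact (g ` {0..1})"
    using assms(2) by (intro compact_continuous_image) auto
  then obtain M where "\<forall>x\<in>g ` {0..1}. norm x \<le> M"
    using compact_imp_bounded bounded_iff by metis
  then have M: "norm (g (frac t)) \<le> M" for t
    using frac_ge_0[of t] frac_lt_1[of t] by (simp add: less_imp_le)
  have bound: "norm (self_similar \<Lambda> g t) \<le> exp (ln \<Lambda> * t) * M" for t
  proof -
    have "\<Lambda> powi \<lfloor>t\<rfloor> = \<Lambda> powr of_int \<lfloor>t\<rfloor>"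
      using assms(1) by (simp add: powr_real_of_int')
    also have "\<dots> \<le> \<Lambda> powr t"
      using assms(1) by (intro powr_mono) auto
    also have "\<dots> = exp (ln \<Lambda> * t)"
      using assms(1) by (simp add: powr_def mult.commute)
    finally show ?thesis
      unfolding self_similar_def norm_scaleR using assms(1) M[of t]
      by (intro mult_mono) auto
  qed
  have "((\<lambda>t. exp (ln \<Lambda> * t) * M) \<longlongrightarrow> 0 * M) at_bot"
    by (rule tendsto_mult[OF exp_times_at_bot tendsto_const]) (use assms(1) in simp)
  then show ?thesis
    using Lim_null_comparison[OF always_eventually[OF allI[OF bound]]] by simp
qed

lemma self_similar_has_vector_derivative:
  fixes g :: "real \<Rightarrow> 'a::real_normed_vector"
  assumes "\<Lambda> \<noteq> 0" "g 1 = \<Lambda> *\<^sub>R g 0" "frac t \<noteq> 0" "(g has_vector_derivative g') (at (frac t))"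
  shows "(self_similar \<Lambda> g has_vector_derivative \<Lambda> powi \<lfloor>t\<rfloor> *\<^sub>R g') (at t)"
proof (rule has_vector_derivative_transform_within_open)
  let ?n = "of_int \<lfloor>t\<rfloor> :: real"
  show "t \<in> {?n<..<?n + 1}"
  proof -
    have "0 < frac t"
      using assms(3) frac_ge_0[of t] by linarith
    then show ?thesis
      using frac_lt_1[of t] unfolding frac_def by auto
  qed
  have "((\<lambda>u. u - ?n) has_vector_derivative 1) (at t)"
    by (auto intro!: derivative_eq_intros)
  then have "(g \<circ> (\<lambda>u. u - ?n) has_vector_derivative 1 *\<^sub>R g') (at t)"
    using assms(4) by (intro vector_diff_chain_at) (auto simp: frac_def)
  then have "((\<lambda>u. g (u - ?n)) has_vector_derivative g') (at t)"
    by (simp add: o_def)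
  then show "((\<lambda>u. \<Lambda> powi \<lfloor>t\<rfloor> *\<^sub>R g (u - ?n)) has_vector_derivative \<Lambda> powi \<lfloor>t\<rfloor> *\<^sub>R g') (at t)"
    by (auto intro!: derivative_eq_intros)
  show "\<Lambda> powi \<lfloor>t\<rfloor> *\<^sub>R g (u - ?n) = self_similar \<Lambda> g u" if "u \<in> {?n<..<?n + 1}" for u
    using self_similar_cell'[OF assms(1,2), of u "\<lfloor>t\<rfloor>"] that by simp
qed simp

text \<open>The condition \<open>z 1 = \<Lambda> * z 0\<close> determines the constant of
  integration: the cell j periods earlier has length (z 1 - z 0) / \<Lambda>^j, and these lengths
  form a geometric series with sum z 0. So z 0 is the length already travelled.\<close>

lemma arc_length_self_similar:
  fixes g :: "real \<Rightarrow> point" and z :: "real \<Rightarrow> real"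
  assumes "1 < \<Lambda>" "finite M"
    and g: "continuous_on {0..1} g" "g 1 = \<Lambda> *\<^sub>R g 0"
    and z: "continuous_on {0..1} z" "z 1 = \<Lambda> * z 0"
    and deriv: "\<And>u. 0 < u \<Longrightarrow> u < 1 \<Longrightarrow> u \<notin> M \<Longrightarrow> (g has_vector_derivative g' u) (at u)"
    and speed: "\<And>u. 0 < u \<Longrightarrow> u < 1 \<Longrightarrow> u \<notin> M \<Longrightarrow> (z has_real_derivative norm (g' u)) (at u)"
  shows "arc_length (self_similar \<Lambda> g) (self_similar \<Lambda> z)"
proof (rule arc_lengthI)
  \<comment> \<open>The integers always count as breakpoints, since the one-sided derivatives of
    consecutive cells need not agree there.\<close>
  let ?N = "{t. frac t \<in> insert 0 M}"
  have z': "z 1 = \<Lambda> *\<^sub>R z 0"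
    using z by simp
  have unit: "0 < frac t" "frac t < 1" "frac t \<notin> M" if "t \<notin> ?N" for t :: real
    using that frac_lt_1[of t] frac_ge_0[of t] by (auto simp: less_le simp del: frac_eq_0_iff frac_gt_0_iff)
  show "finite (?N \<inter> {a..b})" for a b
  proof (rule finite_subset)
    show "?N \<inter> {a..b} \<subseteq> (\<lambda>(n, x). of_int n + x) ` ({\<lfloor>a\<rfloor>..\<lfloor>b\<rfloor>} \<times> insert 0 M)"
    proof
      fix t assume t: "t \<in> ?N \<inter> {a..b}"
      then have "(\<lfloor>t\<rfloor>, frac t) \<in> {\<lfloor>a\<rfloor>..\<lfloor>b\<rfloor>} \<times> insert 0 M"
        by (auto intro: floor_mono)
      moreover have "t = of_int \<lfloor>t\<rfloor> + frac t"
        by (simp add: frac_def)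
      ultimately show "t \<in> (\<lambda>(n, x). of_int n + x) ` ({\<lfloor>a\<rfloor>..\<lfloor>b\<rfloor>} \<times> insert 0 M)"
        by force
    qed
  qed (use assms(2) in auto)
  show "(self_similar \<Lambda> g has_vector_derivative \<Lambda> powi \<lfloor>t\<rfloor> *\<^sub>R g' (frac t)) (at t)" if "t \<notin> ?N" for t
    using assms(1) unit[OF that] by (intro self_similar_has_vector_derivative g deriv) auto
  show "(self_similar \<Lambda> z has_real_derivative norm (\<Lambda> powi \<lfloor>t\<rfloor> *\<^sub>R g' (frac t))) (at t)" if "t \<notin> ?N" for t
  proof -
    have "(self_similar \<Lambda> z has_vector_derivative \<Lambda> powi \<lfloor>t\<rfloor> *\<^sub>R norm (g' (frac t))) (at t)"
      using assms(1) unit[OF that] speed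
      by (intro self_similar_has_vector_derivative z') (auto simp flip: has_real_derivative_iff_has_vector_derivative)
    then show ?thesis
      using assms(1) by (simp add: has_real_derivative_iff_has_vector_derivative)
  qed
  show "continuous_on UNIV (self_similar \<Lambda> g)" "continuous_on UNIV (self_similar \<Lambda> z)"
    using assms(1) by (intro continuous_self_similar g z z'; simp)+
  show "(self_similar \<Lambda> g \<longlongrightarrow> 0) at_bot" "(self_similar \<Lambda> z \<longlongrightarrow> 0) at_bot"
    using assms(1) by (intro self_similar_at_bot g z; simp)+
qed

section \<open>Curves with two pieces per period\<close>

lemma has_vector_derivative_joinpaths:
  fixes p q :: "real \<Rightarrow> 'a::real_normed_vector"
  assumes "\<And>u. 0 < u \<Longrightarrow> u < 1 \<Longrightarrow> (p has_vector_derivative p' u) (at u)"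
    and "\<And>u. 0 < u \<Longrightarrow> u < 1 \<Longrightarrow> (q has_vector_derivative q' u) (at u)"
    and u: "0 < u" "u < 1" "u \<noteq> 1 / 2"
  shows "((p +++ q) has_vector_derivative
    2 *\<^sub>R (if u < 1 / 2 then p' (2 * u) else q' (2 * u - 1))) (at u)"
proof (cases "u < 1 / 2")
  case True
  have "((\<lambda>u. 2 * u) has_vector_derivative 2) (at u)"
    by (auto intro!: derivative_eq_intros)
  then have "(p \<circ> (\<lambda>u. 2 * u) has_vector_derivative 2 *\<^sub>R p' (2 * u)) (at u)"
    using True u by (intro vector_diff_chain_at assms) auto
  then have "((p +++ q) has_vector_derivative 2 *\<^sub>R p' (2 * u)) (at u)"
    by (rule has_vector_derivative_transform_within_open[where S = "{..<1/2}"])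
      (use True in \<open>auto simp: joinpaths_def\<close>)
  then show ?thesis
    using True by simp
next
  case False
  have "((\<lambda>u. 2 * u - 1) has_vector_derivative 2) (at u)"
    by (auto intro!: derivative_eq_intros)
  then have "(q \<circ> (\<lambda>u. 2 * u - 1) has_vector_derivative 2 *\<^sub>R q' (2 * u - 1)) (at u)"
    using False u by (intro vector_diff_chain_at assms) auto
  then have "((p +++ q) has_vector_derivative 2 *\<^sub>R q' (2 * u - 1)) (at u)"
    by (rule has_vector_derivative_transform_within_open[where S = "{1/2<..}"])
      (use False u in \<open>auto simp: joinpaths_def\<close>)
  then show ?thesis
    using False by simp
qed

text \<open>Common frame of the cone strategy: a spiral arc followed by a chord for the fast agent,
  two chords for the slow one. The functions x and y are the lengths along the pieces, including all
  earlier periods.\<close>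

locale two_piece_curve =
  fixes \<Lambda> :: real and p q :: "real \<Rightarrow> point" and p' q' :: "real \<Rightarrow> point" and x y :: "real \<Rightarrow> real"
  assumes \<Lambda>: "1 < \<Lambda>"
    and p: "\<And>u. (p has_vector_derivative p' u) (at u)" "\<And>u. (x has_real_derivative norm (p' u)) (at u)"
    and q: "\<And>u. (q has_vector_derivative q' u) (at u)" "\<And>u. (y has_real_derivative norm (q' u)) (at u)"
    and joins: "q 0 = p 1" "q 1 = \<Lambda> *\<^sub>R p 0" "y 0 = x 1" "y 1 = \<Lambda> * x 0"
begin

definition curve :: "real \<Rightarrow> point" where
  "curve = self_similar \<Lambda> (p +++ q)"

definition len :: "real \<Rightarrow> real" where
  "len = self_similar \<Lambda> (x +++ y)"

lemma arc_length_curve: "arc_length curve len"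
  unfolding curve_def len_def
proof (rule arc_length_self_similar[where M = "{1/2}"])
  have "continuous_on {0..1} p" "continuous_on {0..1} q" "continuous_on {0..1} x" "continuous_on {0..1} y"
    by (intro continuous_at_imp_continuous_on ballI
        has_vector_derivative_continuous[OF p(1)] has_vector_derivative_continuous[OF q(1)]
        DERIV_isCont[OF p(2)] DERIV_isCont[OF q(2)])+
  then have "path (p +++ q)" "path (x +++ y)"
    using joins by (subst path_join; simp add: path_def pathfinish_def pathstart_def)+
  then show "continuous_on {0..1} (p +++ q)" "continuous_on {0..1} (x +++ y)"
    by (auto simp: path_def)
  show "(p +++ q) 1 = \<Lambda> *\<^sub>R (p +++ q) 0" "(x +++ y) 1 = \<Lambda> * (x +++ y) 0"
    using joins by (auto simp: joinpaths_def)
  fix u :: real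
  assume u: "0 < u" "u < 1" "u \<notin> {1/2}"
  show "((p +++ q) has_vector_derivative 2 *\<^sub>R (if u < 1 / 2 then p' (2 * u) else q' (2 * u - 1))) (at u)"
    using u p q by (intro has_vector_derivative_joinpaths) auto
  have "((x +++ y) has_vector_derivative
      2 *\<^sub>R (if u < 1 / 2 then norm (p' (2 * u)) else norm (q' (2 * u - 1)))) (at u)"
    using u p q
    by (intro has_vector_derivative_joinpaths) (auto simp flip: has_real_derivative_iff_has_vector_derivative)
  then show "((x +++ y) has_real_derivative norm (2 *\<^sub>R (if u < 1 / 2 then p' (2 * u) else q' (2 * u - 1)))) (at u)"
    by (simp add: has_real_derivative_iff_has_vector_derivative split: if_splits)
qed (use \<Lambda> in auto)

lemma first_piece:
  assumes "0 \<le> u" "u \<le> 1"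
  shows "curve (of_int n + u / 2) = \<Lambda> powi n *\<^sub>R p u" "len (of_int n + u / 2) = \<Lambda> powi n * x u"
  using \<Lambda> assms joins
    self_similar_cell[of \<Lambda> "p +++ q" "u / 2" n] self_similar_cell[of \<Lambda> "x +++ y" "u / 2" n]
  by (simp_all add: curve_def len_def joinpaths_def)

lemma second_piece:
  assumes "0 \<le> u" "u \<le> 1"
  shows "curve (of_int n + (u + 1) / 2) = \<Lambda> powi n *\<^sub>R q u"
    "len (of_int n + (u + 1) / 2) = \<Lambda> powi n * y u"
proof -
  have "(p +++ q) ((u + 1) / 2) = q u" "(x +++ y) ((u + 1) / 2) = y u"
  proof -
    have u: "2 * ((u + 1) / 2) - 1 = u" "(u + 1) / 2 \<le> 1 / 2 \<longleftrightarrow> u = 0"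
      using assms(1) by (auto simp: field_simps)
    show "(p +++ q) ((u + 1) / 2) = q u" "(x +++ y) ((u + 1) / 2) = y u"
      unfolding joinpaths_def u by (simp_all add: joins)
  qed
  then show "curve (of_int n + (u + 1) / 2) = \<Lambda> powi n *\<^sub>R q u"
    "len (of_int n + (u + 1) / 2) = \<Lambda> powi n * y u"
    using \<Lambda> assms joins
      self_similar_cell[of \<Lambda> "p +++ q" "(u + 1) / 2" n] self_similar_cell[of \<Lambda> "x +++ y" "(u + 1) / 2" n]
    by (simp_all add: curve_def len_def joinpaths_def)
qed

lemma parameter_cases:
  fixes t :: real
  obtains n u where "0 \<le> u" "u \<le> 1" "t = of_int n + u / 2" | n u where "0 \<le> u" "u \<le> 1" "t = of_int n + (u + 1) / 2"
proof (cases "frac t \<le> 1 / 2")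
  case True
  have *: "t = of_int \<lfloor>t\<rfloor> + (2 * frac t) / 2"
    by (simp add: frac_def field_simps)
  show ?thesis
    by (rule that(1)[OF _ _ *]) (use True frac_ge_0[of t] in auto)
next
  case False
  have *: "t = of_int \<lfloor>t\<rfloor> + (2 * frac t - 1 + 1) / 2"
    by (simp add: frac_def field_simps)
  show ?thesis
    by (rule that(2)[OF _ _ *]) (use False frac_lt_1[of t] in auto)
qed

end

section \<open>The constants \<open>\<kappa>\<close> and \<open>U\<close>\<close>

lemma kappa:
  assumes "0 < i"
  shows "0 < kappa i" "kappa i ^ 3 + kappa i = real i / (2 * pi)"
proof -
  let ?c = "real i / (2 * pi)"
  have c: "0 < ?c"
    using assms by simp
  have mono: "k ^ 3 + k < k' ^ 3 + k'" if "0 < k" "k < k'" for k k' :: real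
    using that power_strict_mono[of k k' 3] by linarith
  have "\<exists>k\<ge>0. k \<le> ?c \<and> k ^ 3 + k = ?c"
    using c by (intro IVT) (auto intro!: continuous_intros)
  then obtain k where k: "0 \<le> k" "k ^ 3 + k = ?c"
    by auto
  then have "0 < k"
    using c by (cases "k = 0") auto
  have "\<exists>!k. 0 < k \<and> k ^ 3 + k = ?c"
  proof (rule ex1I[of _ k])
    show "k' = k" if "0 < k' \<and> k' ^ 3 + k' = ?c" for k'
      using mono[of k k'] mono[of k' k] that k(2) \<open>0 < k\<close> by (metis less_irrefl linorder_neqE_linordered_idom)
  qed (use k \<open>0 < k\<close> in auto)
  from theI'[OF this] show "0 < kappa i" "kappa i ^ 3 + kappa i = ?c"
    by (auto simp: kappa_def)
qed

lemma kappa_less: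
  assumes "0 < i" "0 < b" "real i / (2 * pi) < b ^ 3 + b"
  shows "kappa i < b"
proof (rule ccontr)
  assume "\<not> kappa i < b"
  then have "b ^ 3 + b \<le> kappa i ^ 3 + kappa i"
    using assms by (intro add_mono power_mono) auto
  then show False
    using assms kappa[OF assms(1)] by simp
qed

lemma less_kappa:
  assumes "0 < i" "0 < b" "b ^ 3 + b < real i / (2 * pi)"
  shows "b < kappa i"
proof (rule ccontr)
  assume "\<not> b < kappa i"
  then have "kappa i ^ 3 + kappa i \<le> b ^ 3 + b"
    using assms kappa[OF assms(1)] by (intro add_mono power_mono) auto
  then show False
    using assms kappa[OF assms(1)] by simp
qed

lemma sqrt_quotient:
  fixes s :: real
  assumes "0 < s"
  shows "sqrt (1 + s\<^sup>2) / s = sqrt (1 + 1 / s\<^sup>2)"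
proof -
  have "sqrt (1 + 1 / s\<^sup>2) = sqrt ((1 + s\<^sup>2) / s\<^sup>2)"
    using assms by (simp add: field_simps)
  then show ?thesis
    using assms by (simp add: real_sqrt_divide)
qed

text \<open>The logarithm f of the right-hand side has derivative 2 pi - 1 / (s^3 + s). By the
  defining equation of \<open>kappa 1\<close> it vanishes there, and monotonicity of s^3 + s gives
  its sign on either side.\<close>

lemma cal_U_1_le:
  assumes "0 < s"
  shows "cal_U 1 \<le> sqrt (1 + s\<^sup>2) / s * exp (2 * pi * s)"
proof -
  define k where "k = kappa 1"
  have k: "0 < k" "k ^ 3 + k = 1 / (2 * pi)"
    using kappa[of 1] by (auto simp: k_def)
  define f where "f s = ln (1 + s\<^sup>2) / 2 - ln s + 2 * pi * s" for s :: real
  have f: "exp (f s) = sqrt (1 + s\<^sup>2) / s * exp (2 * pi * s)" if "0 < s" for s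
    using that by (simp add: f_def exp_add exp_diff ln_sqrt[symmetric] add_pos_nonneg)
  have f': "(f has_real_derivative 2 * pi - 1 / (s ^ 3 + s)) (at s)" if "0 < s" for s
  proof -
    have "1 + s\<^sup>2 > 0"
      by (simp add: add_pos_nonneg)
    then have "((\<lambda>s. ln (1 + s\<^sup>2)) has_real_derivative 2 * s / (1 + s\<^sup>2)) (at s)"
      by (auto intro!: derivative_eq_intros)
    moreover have "(ln has_real_derivative 1 / s) (at s)"
      using that by (auto intro!: derivative_eq_intros)
    ultimately have "(f has_real_derivative (2 * s / (1 + s\<^sup>2)) / 2 - 1 / s + 2 * pi) (at s)"
      unfolding f_def by (intro DERIV_add DERIV_diff DERIV_cdivide DERIV_cmult_Id)
    moreover have "(2 * s / (1 + s\<^sup>2)) / 2 - 1 / s = - 1 / (s ^ 3 + s)"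
    proof -
      have "s ^ 3 + s = s * (1 + s\<^sup>2)"
        by algebra
      then show ?thesis
        using that \<open>1 + s\<^sup>2 > 0\<close> by (simp add: divide_simps power2_eq_square)
    qed
    ultimately show ?thesis
      by simp
  qed
  have "f k \<le> f s"
  proof (cases "s \<le> k")
    case True
    show ?thesis
    proof (rule DERIV_nonpos_imp_nonincreasing[OF True])
      fix x assume x: "s \<le> x" "x \<le> k"
      then have "x ^ 3 + x \<le> 1 / (2 * pi)"
        using assms k power_mono[of x k 3] by linarith
      then have "2 * pi \<le> 1 / (x ^ 3 + x)"
        using assms x by (simp add: field_simps add_pos_pos)
      then show "\<exists>y. DERIV f x :> y \<and> y \<le> 0"
        using f'[of x] assms x by force
    qed
  next
    case False
    show ?thesis
    proof (rule DERIV_nonneg_imp_nondecreasing[of k s])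
      fix x assume x: "k \<le> x" "x \<le> s"
      then have "1 / (2 * pi) \<le> x ^ 3 + x"
        using k power_mono[of k x 3] by linarith
      then have "1 / (x ^ 3 + x) \<le> 2 * pi"
        using k x by (simp add: field_simps add_pos_pos)
      then show "\<exists>y. DERIV f x :> y \<and> 0 \<le> y"
        using f'[of x] k x by force
    qed (use False in simp)
  qed
  then have "exp (f k) \<le> exp (f s)"
    by simp
  then show ?thesis
    using f[OF k(1)] f[OF assms] by (simp add: cal_U_def k_def)
qed

text \<open>The equation of \<open>kappa 1\<close> removes pi from the exponent. In this form both
  factors decrease in \<open>kappa 1\<close>, so a one-sided bound of \<open>kappa 1\<close> bounds
  \<open>cal_U 1\<close>.\<close>

lemma cal_U_1_eq: "cal_U 1 = sqrt (1 + 1 / (kappa 1)\<^sup>2) * exp (1 / (1 + (kappa 1)\<^sup>2))"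
proof -
  have k: "0 < kappa 1" "kappa 1 * (1 + (kappa 1)\<^sup>2) = 1 / (2 * pi)"
    using kappa[of 1] by (simp_all add: power2_eq_square power3_eq_cube algebra_simps)
  have "1 + (kappa 1)\<^sup>2 > 0"
    by (simp add: add_pos_nonneg)
  then have "2 * pi * kappa 1 = 1 / (1 + (kappa 1)\<^sup>2)"
    using k(2) by (simp add: field_simps)
  then show ?thesis
    unfolding cal_U_def sqrt_quotient[OF k(1)] by (simp del: One_nat_def)
qed

lemma cal_U_1_pos: "0 < cal_U 1"
  unfolding cal_U_1_eq by (intro mult_pos_pos) (auto intro: add_pos_nonneg)

lemma exp_ge_sum:
  fixes x :: real
  assumes "0 \<le> x"
  shows "(\<Sum>n<N. x ^ n / fact n) \<le> exp x"
proof -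
  have "(\<lambda>n. x ^ n / fact n) sums exp x"
    using exp_converges[of x] by (simp add: field_simps scaleR_conv_of_real)
  then show ?thesis
    using assms sum_le_suminf[of "\<lambda>n. x ^ n / fact n" "{..<N}"] by (auto simp: sums_iff)
qed

text \<open>Since U_1 is about 17.28935, the product exceeds 1 by less than 10^-6. This is why
  \<open>kappa 1\<close> is bounded to eight decimals and the exponential by twelve terms of its
  series, whose terms are positive.\<close>

lemma cal_U_1_lower: "1 < 0.0578391 * cal_U 1"
proof -
  let ?b = "0.15540203 :: real"
  have "kappa 1 < ?b"
    by (rule kappa_less) (use pi_approx(1) in \<open>simp_all add: field_simps power3_eq_cube\<close>)
  then have sq: "0 < (kappa 1)\<^sup>2" "(kappa 1)\<^sup>2 \<le> ?b\<^sup>2"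
    using kappa(1)[of 1] by (intro zero_less_power power_mono; linarith)+
  have "1 / ?b\<^sup>2 \<le> 1 / (kappa 1)\<^sup>2"
    using sq by (intro divide_left_mono mult_pos_pos) auto
  moreover have "6.512159\<^sup>2 \<le> 1 + 1 / ?b\<^sup>2"
    by (simp add: power2_eq_square)
  ultimately have "6.512159\<^sup>2 \<le> 1 + 1 / (kappa 1)\<^sup>2"
    by linarith
  then have 1: "6.512159 \<le> sqrt (1 + 1 / (kappa 1)\<^sup>2)"
    by (rule real_le_rsqrt)
  have "0.9764196 \<le> 1 / (1 + ?b\<^sup>2)"
    by (simp add: power2_eq_square)
  also have "\<dots> \<le> 1 / (1 + (kappa 1)\<^sup>2)"
    using sq by (intro divide_left_mono add_left_mono mult_pos_pos) (auto simp: add_pos_nonneg)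
  finally have "exp 0.9764196 \<le> exp (1 / (1 + (kappa 1)\<^sup>2))"
    by simp
  moreover have "(\<Sum>n<12. 0.9764196 ^ n / fact n) \<le> exp (0.9764196 :: real)"
    by (rule exp_ge_sum) simp
  moreover have "(2.654933 :: real) \<le> (\<Sum>n<12. 0.9764196 ^ n / fact n)"
    by (simp add: eval_nat_numeral fact_numeral field_simps)
  ultimately have 2: "2.654933 \<le> exp (1 / (1 + (kappa 1)\<^sup>2))"
    by linarith
  have "6.512159 * 2.654933 \<le> cal_U 1"
    unfolding cal_U_1_eq using 1 2 by (intro mult_mono) auto
  then show ?thesis
    by simp
qed

lemma cal_U_1_upper: "cal_U 1 \<le> 17.36"
proof -
  have "0.155 < kappa 1"
    by (rule less_kappa) (use pi_approx(2) in \<open>simp_all add: field_simps power3_eq_cube\<close>)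
  then have sq: "0.155\<^sup>2 \<le> (kappa 1)\<^sup>2"
    by (intro power_mono) auto
  then have "1 + 1 / (kappa 1)\<^sup>2 \<le> 1 + 1 / 0.155\<^sup>2"
    by (intro add_left_mono divide_left_mono mult_pos_pos) (auto intro: less_le_trans[rotated])
  also have "\<dots> \<le> 6.529\<^sup>2"
    by (simp add: power2_eq_square)
  finally have 1: "sqrt (1 + 1 / (kappa 1)\<^sup>2) \<le> 6.529"
    by (intro real_le_lsqrt) (auto simp: add_nonneg_nonneg)
  have "1 / (1 + (kappa 1)\<^sup>2) \<le> 1 / (1 + 0.155\<^sup>2)"
    using sq by (intro divide_left_mono add_left_mono mult_pos_pos) (auto simp: add_pos_nonneg)
  \<comment> \<open>Splitting off exp 1 reduces the exponential to \<open>e_less_272\<close> and exp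
    x \<ge> 1 + x. Modest precision suffices: the result only bounds R from above in
    \<open>gamma_fun_large\<close>.\<close>
  also have "\<dots> \<le> 1 - 0.0234"
    by (simp add: power2_eq_square)
  finally have "exp (1 / (1 + (kappa 1)\<^sup>2)) \<le> exp (1 - 0.0234)"
    by simp
  also have "\<dots> = exp 1 / exp 0.0234"
    by (rule exp_diff)
  also have "\<dots> \<le> 2.72 / 1.0234"
    using e_less_272 exp_ge_add_one_self[of "0.0234"] by (intro frac_le) auto
  finally have 2: "exp (1 / (1 + (kappa 1)\<^sup>2)) \<le> 2.72 / 1.0234" .
  have "cal_U 1 \<le> 6.529 * (2.72 / 1.0234)"
    unfolding cal_U_1_eq using 1 2 by (intro mult_mono) auto
  then show ?thesis
    by simp
qed

section \<open>The minima \<open>R\<close> and \<open>F\<close>\<close>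

text \<open>By uniform continuity on the compact product, a minimiser for one parameter is almost
  optimal for nearby ones; for this K must not depend on the parameter. The minimum is described by
  its two properties, to fit values defined by \<open>LEAST\<close>.\<close>

lemma continuous_on_minimum:
  fixes f :: "'a::metric_space \<Rightarrow> 'b::metric_space \<Rightarrow> real"
  assumes "compact K" "compact X" and cont: "continuous_on (K \<times> X) (\<lambda>(k, x). f k x)"
    and attained: "\<And>x. x \<in> X \<Longrightarrow> \<exists>k\<in>K. m x = f k x"
    and le: "\<And>x k. x \<in> X \<Longrightarrow> k \<in> K \<Longrightarrow> m x \<le> f k x"
  shows "continuous_on X m"
  unfolding continuous_on_iff
proof (intro ballI allI impI)
  fix x e assume x: "x \<in> X" and e: "(0::real) < e"
  have "uniformly_continuous_on (K \<times> X) (\<lambda>(k, x). f k x)"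
    using assms by (intro compact_uniformly_continuous compact_Times)
  then obtain d where d: "0 < d"
    "\<And>p q. p \<in> K \<times> X \<Longrightarrow> q \<in> K \<times> X \<Longrightarrow> dist q p < d \<Longrightarrow> dist ((\<lambda>(k, x). f k x) q) ((\<lambda>(k, x). f k x) p) < e"
    using e unfolding uniformly_continuous_on_def by metis
  have close: "\<bar>f k y - f k z\<bar> < e" if "k \<in> K" "y \<in> X" "z \<in> X" "dist y z < d" for k y z
    using d(2)[of "(k, z)" "(k, y)"] that by (simp add: dist_Pair_Pair dist_real_def)
  have half: "m z < m y + e" if yz: "y \<in> X" "z \<in> X" "dist y z < d" for y z
  proof -
    obtain k where "k \<in> K" "m y = f k y"
      using attained yz by blast
    then show ?thesis
      using le[of z k] close[of k y z] yz by linarith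
  qed
  show "\<exists>d>0. \<forall>x'\<in>X. dist x' x < d \<longrightarrow> dist (m x') (m x) < e"
  proof (intro exI conjI ballI impI)
    fix y assume "y \<in> X" "dist y x < d"
    then show "dist (m y) (m x) < e"
      using half[of x y] half[of y x] x by (simp add: dist_real_def dist_commute abs_less_iff)
  qed fact
qed

text \<open>The objective of \<open>cal_R\<close> in the variable \<open>s = (\<lambda> - 1) / sqrt (2 \<lambda> (1 - cos \<phi>))\<close>, that is,
  \<open>sqrt \<lambda> - 1 / sqrt \<lambda> = 2 s sin (\<phi> / 2)\<close>. For \<open>\<phi> = 0\<close> it is the objective minimised by \<open>cal_U 1\<close>.\<close>

definition jump :: "real \<Rightarrow> real \<Rightarrow> real" where
  "jump s \<phi> = (s * sin (\<phi> / 2) + sqrt (1 + (s * sin (\<phi> / 2))\<^sup>2))\<^sup>2"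

definition R_cost :: "real \<Rightarrow> real \<Rightarrow> real" where
  "R_cost s \<phi> = jump s \<phi> * (sqrt (1 + s\<^sup>2) / s) * exp (s * (2 * pi - \<phi>))"

text \<open>With x = sqrt \<lambda> the substitution is the quadratic equation x^2 - 2 \<sigma> x -
  1 = 0, and \<open>jump\<close> is the square of its positive root for \<sigma> = s sin (\<phi> /
  2).\<close>

lemma sqrt_jump:
  fixes x \<sigma> :: real
  assumes "0 < x"
  shows "x - 1 / x = 2 * \<sigma> \<longleftrightarrow> x = \<sigma> + sqrt (1 + \<sigma>\<^sup>2)"
proof
  assume eq: "x - 1 / x = 2 * \<sigma>"
  then have "x\<^sup>2 - 1 = 2 * \<sigma> * x"
    using assms by (simp add: field_simps power2_eq_square)
  then have "(x - \<sigma>)\<^sup>2 = 1 + \<sigma>\<^sup>2"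
    by (simp add: power2_eq_square algebra_simps)
  moreover have "0 \<le> x - \<sigma>"
  proof -
    have "x - \<sigma> = (x + 1 / x) / 2"
      using eq by (simp add: field_simps)
    also have "\<dots> \<ge> 0"
      using assms by simp
    finally show ?thesis .
  qed
  ultimately have "x - \<sigma> = sqrt (1 + \<sigma>\<^sup>2)"
    by (metis real_sqrt_unique)
  then show "x = \<sigma> + sqrt (1 + \<sigma>\<^sup>2)"
    by simp
next
  assume "x = \<sigma> + sqrt (1 + \<sigma>\<^sup>2)"
  then have "(x - \<sigma>)\<^sup>2 = 1 + \<sigma>\<^sup>2"
    by (simp add: add_nonneg_nonneg)
  then have "x\<^sup>2 - 1 = 2 * \<sigma> * x"
    by (simp add: power2_eq_square algebra_simps)
  then show "x - 1 / x = 2 * \<sigma>"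
    using assms by (simp add: field_simps power2_eq_square)
qed

lemma jump_gt_1:
  assumes "0 < s" "0 < \<phi>" "\<phi> < pi"
  shows "1 < jump s \<phi>"
proof -
  have "0 < s * sin (\<phi> / 2)"
    using assms by (intro mult_pos_pos sin_gt_zero) auto
  moreover have "1 \<le> sqrt (1 + (s * sin (\<phi> / 2))\<^sup>2)"
    by simp
  ultimately have "1 < s * sin (\<phi> / 2) + sqrt (1 + (s * sin (\<phi> / 2))\<^sup>2)"
    by linarith
  then show ?thesis
    unfolding jump_def by (intro one_less_power) auto
qed

text \<open>By the law of cosines the square of the chord is (l - 1)^2 + (2 sin (\<phi> / 2))^2 l.
  The choice of l turns the second summand into ((l - 1) / s)^2, so chord and spiral have the same
  ratio of length to gain of radius.\<close>

lemma jump_chord: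
  assumes "0 < s" "0 < \<phi>" "\<phi> < pi"
  defines "l \<equiv> jump s \<phi>"
  shows "s = (l - 1) / sqrt (2 * l * (1 - cos \<phi>))"
    and "sqrt (l\<^sup>2 - 2 * l * cos \<phi> + 1) = (l - 1) * (sqrt (1 + s\<^sup>2) / s)"
proof -
  define h where "h = sin (\<phi> / 2)"
  have h: "0 < h" "1 - cos \<phi> = 2 * h\<^sup>2"
    using assms cos_double_sin[of "\<phi> / 2"] by (auto simp: h_def intro: sin_gt_zero)
  define x where "x = s * h + sqrt (1 + (s * h)\<^sup>2)"
  have x: "l = x\<^sup>2"
    by (simp add: l_def jump_def x_def h_def)
  have l: "1 < l"
    using jump_gt_1 assms by simp
  have "0 < x"
    unfolding x_def using assms(1) h(1) by (intro add_pos_nonneg) auto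
  then have "x - 1 / x = 2 * (s * h)"
    using sqrt_jump x_def by blast
  then have *: "l - 1 = 2 * s * h * x"
    using \<open>0 < x\<close> by (simp add: x field_simps power2_eq_square)
  have "sqrt (2 * l * (1 - cos \<phi>)) = sqrt ((2 * h * x)\<^sup>2)"
    by (simp add: h x power_mult_distrib)
  then have "sqrt (2 * l * (1 - cos \<phi>)) = 2 * h * x"
    using h \<open>0 < x\<close> by simp
  then show "s = (l - 1) / sqrt (2 * l * (1 - cos \<phi>))"
    using h \<open>0 < x\<close> by (simp add: *)
  have c: "cos \<phi> = 1 - 2 * h\<^sup>2"
    using h(2) by simp
  have "(l\<^sup>2 - 2 * l * cos \<phi> + 1) = (l - 1)\<^sup>2 + (2 * h * x)\<^sup>2"
    unfolding x c by (simp add: power2_eq_square algebra_simps)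
  also have "2 * h * x = (l - 1) / s"
    using assms(1) by (simp add: *)
  also have "(l - 1)\<^sup>2 + ((l - 1) / s)\<^sup>2 = (l - 1)\<^sup>2 * (1 + 1 / s\<^sup>2)"
    by (simp add: power_divide algebra_simps)
  finally show "sqrt (l\<^sup>2 - 2 * l * cos \<phi> + 1) = (l - 1) * (sqrt (1 + s\<^sup>2) / s)"
    using l by (simp add: real_sqrt_mult sqrt_quotient[OF assms(1)])
qed

lemma cal_R_objective:
  assumes "0 < s" "0 < \<phi>" "\<phi> < pi"
  defines "l \<equiv> jump s \<phi>"
  shows "sqrt (l\<^sup>2 - 2 * l * cos \<phi> + 1) / (l - 1) * exp (2 * pi * k_fun \<phi> l) = R_cost s \<phi>"
proof -
  have l: "1 < l"
    using jump_gt_1 assms by simp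
  have "2 * pi * k_fun \<phi> l = ln l + s * (2 * pi - \<phi>)"
    unfolding k_fun_def jump_chord(1)[OF assms(1-3), folded l_def, symmetric]
    by (simp add: field_simps)
  then have "exp (2 * pi * k_fun \<phi> l) = l * exp (s * (2 * pi - \<phi>))"
    using l by (simp add: exp_add)
  then show ?thesis
    using l unfolding jump_chord(2)[OF assms(1-3), folded l_def] by (simp add: R_cost_def l_def)
qed

lemma jump_surj:
  assumes "1 < l" "0 < \<phi>" "\<phi> < pi"
  obtains s where "0 < s" "l = jump s \<phi>"
proof -
  define h where "h = sin (\<phi> / 2)"
  have h: "0 < h"
    using assms by (auto simp: h_def intro: sin_gt_zero)
  define x where "x = sqrt l"
  have x: "1 < x" "l = x\<^sup>2"
    using assms by (auto simp: x_def)
  define s where "s = (x - 1 / x) / (2 * h)"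
  have "1 / x < x"
    using x by (simp add: field_simps) (metis less_1_mult)
  then have s: "0 < s"
    using h by (simp add: s_def)
  have "x - 1 / x = 2 * (s * h)"
    using h by (simp add: s_def)
  then have "x = s * h + sqrt (1 + (s * h)\<^sup>2)"
    using sqrt_jump[of x] x(1) by simp
  then have "l = jump s \<phi>"
    by (metis x(2) jump_def h_def)
  then show ?thesis
    using that s by blast
qed

lemma cal_R_eqI:
  assumes "0 < \<phi>" "\<phi> < pi" "0 < s" and min: "\<And>s'. 0 < s' \<Longrightarrow> R_cost s \<phi> \<le> R_cost s' \<phi>"
  shows "cal_R \<phi> = R_cost s \<phi>"
  unfolding cal_R_def
proof (rule Least_equality)
  show "\<exists>l\<in>{1<..}. R_cost s \<phi> = sqrt (l\<^sup>2 - 2 * l * cos \<phi> + 1) / (l - 1) * exp (2 * pi * k_fun \<phi> l)"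
    using cal_R_objective[OF assms(3,1,2)] jump_gt_1[OF assms(3,1,2)] by (auto intro!: bexI[of _ "jump s \<phi>"])
next
  fix v
  assume "\<exists>l\<in>{1<..}. v = sqrt (l\<^sup>2 - 2 * l * cos \<phi> + 1) / (l - 1) * exp (2 * pi * k_fun \<phi> l)"
  then obtain l where l: "1 < l" "v = sqrt (l\<^sup>2 - 2 * l * cos \<phi> + 1) / (l - 1) * exp (2 * pi * k_fun \<phi> l)"
    by auto
  obtain s' where "0 < s'" "l = jump s' \<phi>"
    using jump_surj[OF l(1) assms(1,2)] by blast
  then show "R_cost s \<phi> \<le> v"
    using min[of s'] cal_R_objective[of s' \<phi>] assms l(2) by simp
qed

text \<open>A chord beats the spiral that would sweep the cone: the jump factor is exp (2 arsinh (k
  sin (\<phi> / 2))), which is below the growth exp (k \<phi>) of the spiral because arsinh \<sigma>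
  \<le> \<sigma> and sin (\<phi> / 2) < \<phi> / 2. For \<open>kappa 1\<close> the full spiral costs
  \<open>cal_U 1\<close>.\<close>

lemma R_cost_kappa_less:
  assumes "0 < \<phi>" "\<phi> < pi"
  shows "R_cost (kappa 1) \<phi> < cal_U 1"
proof -
  define k where "k = kappa 1"
  define \<sigma> where "\<sigma> = k * sin (\<phi> / 2)"
  have k: "0 < k"
    using kappa[of 1] by (simp add: k_def)
  have \<sigma>: "0 < \<sigma>"
    using k assms unfolding \<sigma>_def by (intro mult_pos_pos sin_gt_zero) auto
  have "sin (\<phi> / 2) < \<phi> / 2"
  proof -
    have "sin (\<phi> / 2) = 2 * sin (\<phi> / 4) * cos (\<phi> / 4)"
      using sin_double[of "\<phi> / 4"] by simp
    \<comment> \<open>Strictness comes from cos (\<phi> / 4) < 1.\<close>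
    also have "\<dots> < 2 * sin (\<phi> / 4) * 1"
      using assms cos_monotone_0_pi[of 0 "\<phi> / 4"]
      by (intro mult_strict_left_mono mult_pos_pos sin_gt_zero) auto
    also have "\<dots> \<le> \<phi> / 2"
      using assms sin_x_le_x[of "\<phi> / 4"] by simp
    finally show ?thesis .
  qed
  then have "2 * \<sigma> < k * \<phi>"
    using k by (simp add: \<sigma>_def)
  have "\<sigma> + sqrt (1 + \<sigma>\<^sup>2) = exp (arsinh \<sigma>)"
    using arsinh_real_aux[of \<sigma>] by (simp add: arsinh_real_def add.commute)
  moreover have "arsinh \<sigma> \<le> \<sigma>"
  proof -
    have "\<sigma> \<le> sinh \<sigma>"
      using real_le_x_sinh[of \<sigma>] \<sigma> by (simp add: sinh_field_def exp_minus)
    then have "arsinh \<sigma> \<le> arsinh (sinh \<sigma>)"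
      using arsinh_less_iff_real[of "sinh \<sigma>" \<sigma>] by linarith
    then show ?thesis
      by (simp only: arsinh_sinh_real)
  qed
  ultimately have "jump k \<phi> \<le> exp (2 * \<sigma>)"
    by (simp add: jump_def \<sigma>_def exp_double)
  also have "\<dots> < exp (k * \<phi>)"
    using \<open>2 * \<sigma> < k * \<phi>\<close> by simp
  finally have "R_cost k \<phi> < exp (k * \<phi>) * (sqrt (1 + k\<^sup>2) / k) * exp (k * (2 * pi - \<phi>))"
    unfolding R_cost_def using k by (intro mult_strict_right_mono) (auto simp: add_pos_nonneg)
  also have "\<dots> = sqrt (1 + k\<^sup>2) / k * exp (2 * pi * k)"
    by (simp add: algebra_simps flip: exp_add)
  also have "\<dots> = cal_U 1"
    by (simp add: cal_U_def k_def)
  finally show ?thesis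
    by (simp add: k_def)
qed

lemma R_cost_ge:
  assumes "0 < s" "0 < \<phi>" "\<phi> < pi"
  shows "sqrt (1 + s\<^sup>2) / s * exp (s * (2 * pi - \<phi>)) \<le> R_cost s \<phi>"
proof -
  have "1 * (sqrt (1 + s\<^sup>2) / s * exp (s * (2 * pi - \<phi>))) \<le> jump s \<phi> * (sqrt (1 + s\<^sup>2) / s * exp (s * (2 * pi - \<phi>)))"
    using jump_gt_1[OF assms] assms(1) by (intro mult_right_mono) auto
  then show ?thesis
    by (simp add: R_cost_def mult.assoc)
qed

text \<open>With q = 1 - \<phi> / (2 pi) the exponent s (2 pi - \<phi>) is 2 pi (q s), so the
  objective is compared with that of \<open>cal_U 1\<close> at q s. As \<phi> tends to 0 the bound
  tends to \<open>cal_U 1\<close>.\<close>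

lemma R_cost_lower:
  assumes "0 < s" "0 < \<phi>" "\<phi> < pi"
  shows "(1 - \<phi> / (2 * pi)) * cal_U 1 \<le> R_cost s \<phi>"
proof -
  define q where "q = 1 - \<phi> / (2 * pi)"
  have q: "0 < q" "q \<le> 1"
    using assms by (auto simp: q_def field_simps)
  have "q * cal_U 1 \<le> q * (sqrt (1 + (q * s)\<^sup>2) / (q * s) * exp (2 * pi * (q * s)))"
    using q assms by (intro mult_left_mono cal_U_1_le) auto
  also have "\<dots> = sqrt (1 + (q * s)\<^sup>2) / s * exp (2 * pi * (q * s))"
    using q by simp
  also have "\<dots> \<le> sqrt (1 + s\<^sup>2) / s * exp (2 * pi * (q * s))"
    using q assms by (intro mult_right_mono divide_right_mono real_sqrt_le_mono add_left_mono power_mono)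
      (auto simp: mult_left_le_one_le)
  also have "2 * pi * (q * s) = s * (2 * pi - \<phi>)"
    by (simp add: q_def field_simps)
  finally show ?thesis
    using R_cost_ge[OF assms] by (simp add: q_def)
qed

text \<open>Small s is penalised by 1 / s and large s by the exponential, whose rate 2 pi - \<phi>
  exceeds 1 for every admissible angle. Hence the bounds are uniform in \<phi>.\<close>

lemma R_cost_coercive:
  assumes "0 < s" "0 < \<phi>" "\<phi> < pi" "R_cost s \<phi> \<le> U"
  shows "1 / U \<le> s" "s \<le> U"
proof -
  have *: "1 / s < sqrt (1 + s\<^sup>2) / s" "1 < sqrt (1 + s\<^sup>2) / s" "0 < sqrt (1 + s\<^sup>2) / s"
    using assms(1) real_less_rsqrt[of s "1 + s\<^sup>2"] by (auto simp: divide_strict_right_mono add_pos_pos)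
  have "s * 1 < s * (2 * pi - \<phi>)"
    using assms pi_gt3 by (intro mult_strict_left_mono) auto
  then have e: "s < exp (s * (2 * pi - \<phi>))" "1 < exp (s * (2 * pi - \<phi>))"
    using exp_ge_add_one_self[of "s * (2 * pi - \<phi>)"] assms(1) by linarith+
  have "1 / s * 1 < sqrt (1 + s\<^sup>2) / s * exp (s * (2 * pi - \<phi>))"
    using * e assms(1) by (intro mult_strict_mono) auto
  then have "1 / s < U"
    using R_cost_ge[OF assms(1-3)] assms(4) by linarith
  moreover have "0 < U"
    using less_trans[OF _ \<open>1 / s < U\<close>, of 0] assms(1) by simp
  ultimately show "1 / U \<le> s"
    using assms(1) by (simp add: field_simps)
  have "1 * s < sqrt (1 + s\<^sup>2) / s * exp (s * (2 * pi - \<phi>))"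
    using * e assms(1) by (intro mult_strict_mono) auto
  then show "s \<le> U"
    using R_cost_ge[OF assms(1-3)] assms(4) by linarith
qed

lemma continuous_on_R_cost:
  assumes "0 < a"
  shows "continuous_on ({a..b} \<times> X) (\<lambda>(s, \<phi>). R_cost s \<phi>)"
  unfolding R_cost_def jump_def case_prod_unfold
  using assms by (intro continuous_intros) auto

text \<open>\<open>kappa 1\<close> is a competitor of cost below \<open>cal_U 1\<close>, so every
  minimiser lies in the interval given by coercivity. This interval is the same for all angles, as
  \<open>continuous_on_cal_R\<close> requires.\<close>

lemma cal_R_attained:
  assumes "0 < \<phi>" "\<phi> < pi"
  obtains s where "s \<in> {1 / cal_U 1..cal_U 1}" "cal_R \<phi> = R_cost s \<phi>" "\<And>s'. 0 < s' \<Longrightarrow> cal_R \<phi> \<le> R_cost s' \<phi>"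
proof -
  let ?K = "{1 / cal_U 1..cal_U 1}"
  have k: "0 < kappa 1" "R_cost (kappa 1) \<phi> \<le> cal_U 1"
    using kappa[of 1] R_cost_kappa_less[OF assms] by auto
  have kK: "kappa 1 \<in> ?K"
    using R_cost_coercive[OF k(1) assms k(2)] by simp
  have "continuous_on ?K (\<lambda>s. (\<lambda>(s, \<phi>). R_cost s \<phi>) (s, \<phi>))"
    using cal_U_1_pos by (intro continuous_on_compose2[OF continuous_on_R_cost[of "1 / cal_U 1" "cal_U 1" UNIV]] continuous_intros) auto
  then have "continuous_on ?K (\<lambda>s. R_cost s \<phi>)"
    by simp
  then obtain s where s: "s \<in> ?K" "\<And>s'. s' \<in> ?K \<Longrightarrow> R_cost s \<phi> \<le> R_cost s' \<phi>"
    using continuous_attains_inf[of ?K "\<lambda>s. R_cost s \<phi>"] kK by auto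
  have "0 < 1 / cal_U 1"
    using cal_U_1_pos by simp
  then have "0 < s"
    using s(1) by (meson atLeastAtMost_iff less_le_trans)
  have min: "R_cost s \<phi> \<le> R_cost s' \<phi>" if "0 < s'" for s'
  proof (cases "R_cost s' \<phi> \<le> cal_U 1")
    case True
    then show ?thesis
      using R_cost_coercive[OF that assms True] s(2) by simp
  next
    case False
    then show ?thesis
      using s(2)[OF kK] k(2) by linarith
  qed
  have "cal_R \<phi> = R_cost s \<phi>"
    using assms \<open>0 < s\<close> min by (rule cal_R_eqI)
  then show ?thesis
    using that[OF s(1)] min by simp
qed

lemma cal_R_less:
  assumes "0 < \<phi>" "\<phi> < pi"
  shows "cal_R \<phi> < cal_U 1"
proof -
  have "cal_R \<phi> \<le> R_cost (kappa 1) \<phi>"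
    using cal_R_attained[OF assms] kappa(1)[of 1] by force
  then show ?thesis
    using R_cost_kappa_less[OF assms] by linarith
qed

lemma cal_R_ge:
  assumes "0 < \<phi>" "\<phi> < pi"
  shows "(1 - \<phi> / (2 * pi)) * cal_U 1 \<le> cal_R \<phi>"
proof -
  obtain s where s: "s \<in> {1 / cal_U 1..cal_U 1}" "cal_R \<phi> = R_cost s \<phi>"
    by (rule cal_R_attained[OF assms]) blast
  have "0 < 1 / cal_U 1"
    using cal_U_1_pos by simp
  then have "0 < s"
    using s(1) by (meson atLeastAtMost_iff less_le_trans)
  then show ?thesis
    using R_cost_lower assms s(2) by simp
qed

lemma cal_R_pos:
  assumes "0 < \<phi>" "\<phi> < pi"
  shows "0 < cal_R \<phi>"
proof -
  have "0 < (1 - \<phi> / (2 * pi)) * cal_U 1"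
    using assms cal_U_1_pos by (intro mult_pos_pos) (auto simp: field_simps)
  then show ?thesis
    using cal_R_ge[OF assms] by linarith
qed

lemma continuous_on_cal_R:
  assumes "0 < a" "b < pi"
  shows "continuous_on {a..b} cal_R"
proof (rule continuous_on_minimum)
  show "continuous_on ({1 / cal_U 1..cal_U 1} \<times> {a..b}) (\<lambda>(s, \<phi>). R_cost s \<phi>)"
    using cal_U_1_pos by (intro continuous_on_R_cost) simp
  fix \<phi> assume "\<phi> \<in> {a..b}"
  then have \<phi>: "0 < \<phi>" "\<phi> < pi"
    using assms by auto
  show "\<exists>s\<in>{1 / cal_U 1..cal_U 1}. cal_R \<phi> = R_cost s \<phi>"
    by (rule cal_R_attained[OF \<phi>]) blast
  show "cal_R \<phi> \<le> R_cost s \<phi>" if "s \<in> {1 / cal_U 1..cal_U 1}" for s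
  proof -
    have "0 < 1 / cal_U 1"
      using cal_U_1_pos by simp
    then have "0 < s"
      using that by (meson atLeastAtMost_iff less_le_trans)
    then show ?thesis
      using cal_R_attained[OF \<phi>] by metis
  qed
qed auto

text \<open>The objective of \<open>cal_F\<close> in the variable \<open>y = tan (\<theta> - \<phi> / 2) / tan (\<phi> / 2)\<close>, with \<open>T = tan (\<phi> / 2)\<close>.\<close>

definition F_cost :: "real \<Rightarrow> real \<Rightarrow> real" where
  "F_cost y T = ((y + 1) / (y - 1))\<^sup>2 * sqrt (1 + (T * y)\<^sup>2)"

lemma tan_half_pos: "0 < \<phi> \<Longrightarrow> \<phi> < pi \<Longrightarrow> 0 < tan (\<phi> / 2)"
  by (rule tan_gt_zero) auto

lemma sqrt_one_plus_tan:
  assumes "0 < cos \<alpha>"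
  shows "sqrt (1 + (tan \<alpha>)\<^sup>2) = 1 / cos \<alpha>"
proof (rule real_sqrt_unique)
  show "(1 / cos \<alpha>)\<^sup>2 = 1 + (tan \<alpha>)\<^sup>2"
    using tan_sec[of \<alpha>] assms by (simp add: inverse_eq_divide power_divide)
qed (use assms in simp)

text \<open>Measuring \<theta> from \<phi> / 2 makes the quotient of sines symmetric: sin (\<alpha>
  + h) / sin (\<alpha> - h) is the quotient of the sum and the difference of the tangents of
  \<alpha> and h.\<close>

lemma cal_F_objective:
  assumes "0 < \<phi>" "\<phi> < \<theta>" "\<theta> < pi / 2 + \<phi> / 2"
  shows "(sin \<theta> / sin (\<theta> - \<phi>))\<^sup>2 * (1 / cos (\<theta> - \<phi> / 2))
    = F_cost (tan (\<theta> - \<phi> / 2) / tan (\<phi> / 2)) (tan (\<phi> / 2))"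
proof -
  define h \<alpha> where "h = \<phi> / 2" and "\<alpha> = \<theta> - \<phi> / 2"
  have \<theta>: "\<theta> = \<alpha> + h" "\<theta> - \<phi> = \<alpha> - h" and b: "0 < h" "h < \<alpha>" "\<alpha> < pi / 2"
    using assms by (auto simp: h_def \<alpha>_def)
  have c: "0 < cos h" "0 < cos \<alpha>"
    using b by (auto intro: cos_gt_zero)
  have T: "0 < tan h" "tan h < tan \<alpha>"
    using b tan_monotone[of h \<alpha>] by (auto intro: tan_gt_zero)
  have "sin (\<alpha> + h) = cos \<alpha> * cos h * (tan \<alpha> + tan h)" "sin (\<alpha> - h) = cos \<alpha> * cos h * (tan \<alpha> - tan h)"
    using c by (simp_all add: sin_add sin_diff tan_def field_simps)
  then have "sin (\<alpha> + h) / sin (\<alpha> - h) = (tan \<alpha> + tan h) / (tan \<alpha> - tan h)"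
    using c by simp
  also have "\<dots> = (tan \<alpha> / tan h + 1) / (tan \<alpha> / tan h - 1)"
    using T by (simp add: divide_simps)
  finally show ?thesis
    using T(1) sqrt_one_plus_tan[OF c(2)]
    unfolding \<theta>(2) \<alpha>_def[symmetric] h_def[symmetric] F_cost_def unfolding \<theta>(1) by simp
qed

lemma cal_F_eqI:
  assumes "0 < \<phi>" "\<phi> < pi" "1 < y"
    and min: "\<And>y'. 1 < y' \<Longrightarrow> F_cost y (tan (\<phi> / 2)) \<le> F_cost y' (tan (\<phi> / 2))"
  shows "cal_F \<phi> = F_cost y (tan (\<phi> / 2))"
  unfolding cal_F_def
proof (rule Least_equality)
  define T where "T = tan (\<phi> / 2)"
  have T: "0 < T"
    using assms by (simp add: T_def tan_half_pos)
  define \<theta> where "\<theta> = arctan (T * y) + \<phi> / 2"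
  have "arctan T < arctan (T * y)"
    using T assms by (simp add: arctan_less_iff)
  moreover have "arctan T = \<phi> / 2"
    unfolding T_def using assms by (intro arctan_tan) auto
  ultimately have \<theta>: "\<phi> < \<theta>" "\<theta> < pi / 2 + \<phi> / 2"
    using arctan_ubound[of "T * y"] by (auto simp: \<theta>_def)
  have "tan (\<theta> - \<phi> / 2) / T = y"
    using T by (simp add: \<theta>_def tan_arctan)
  then show "\<exists>\<theta>\<in>{\<phi><..<pi / 2 + \<phi> / 2}.
      F_cost y (tan (\<phi> / 2)) = (sin \<theta> / sin (\<theta> - \<phi>))\<^sup>2 * (1 / cos (\<theta> - \<phi> / 2))"
    using cal_F_objective[OF assms(1) \<theta>] \<theta> by (intro bexI[of _ \<theta>]) (auto simp: T_def)
next
  fix v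
  assume "\<exists>\<theta>\<in>{\<phi><..<pi / 2 + \<phi> / 2}. v = (sin \<theta> / sin (\<theta> - \<phi>))\<^sup>2 * (1 / cos (\<theta> - \<phi> / 2))"
  then obtain \<theta> where \<theta>: "\<phi> < \<theta>" "\<theta> < pi / 2 + \<phi> / 2"
    and v: "v = (sin \<theta> / sin (\<theta> - \<phi>))\<^sup>2 * (1 / cos (\<theta> - \<phi> / 2))"
    by auto
  have "tan (\<phi> / 2) < tan (\<theta> - \<phi> / 2)"
    using assms(1) \<theta> by (intro tan_monotone) auto
  then have "1 < tan (\<theta> - \<phi> / 2) / tan (\<phi> / 2)"
    using tan_half_pos[OF assms(1,2)] by simp
  then show "F_cost y (tan (\<phi> / 2)) \<le> v"
    unfolding v cal_F_objective[OF assms(1) \<theta>] by (rule min)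
qed

text \<open>The angle is restricted to \<open>tan (\<phi> / 2) \<le> 0.42\<close>, which suffices for \<open>gamma_fun\<close> to exceed \<open>0.268872\<close>;
  then \<open>T y = 2.1\<close> is a competitor of cost at most \<open>5.234\<close>.\<close>

lemma F_cost_coercive:
  assumes "0 < T" "1 < y" "F_cost y T \<le> 5.234"
  shows "2 \<le> y" "T * y \<le> 5.14"
proof -
  define r where "r = (y + 1) / (y - 1)"
  have r: "1 < r"
    using assms by (simp add: r_def field_simps)
  then have "1 \<le> r\<^sup>2"
    by (simp add: one_le_power)
  then have "1 * sqrt (1 + (T * y)\<^sup>2) \<le> r\<^sup>2 * sqrt (1 + (T * y)\<^sup>2)"
    by (intro mult_right_mono) auto
  then have "sqrt (1 + (T * y)\<^sup>2) \<le> 5.234"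
    using assms(3) by (simp add: F_cost_def r_def)
  then have "1 + (T * y)\<^sup>2 \<le> 5.234\<^sup>2"
    by (rule sqrt_le_D)
  then have "(T * y)\<^sup>2 \<le> 5.14\<^sup>2"
    by (simp add: power2_eq_square)
  then show "T * y \<le> 5.14"
    by (rule power2_le_imp_le) simp
  have "r\<^sup>2 * 1 \<le> r\<^sup>2 * sqrt (1 + (T * y)\<^sup>2)"
    by (intro mult_left_mono) auto
  then have "r\<^sup>2 \<le> 3\<^sup>2"
    using assms(3) by (simp add: F_cost_def r_def)
  then have "r \<le> 3"
    by (rule power2_le_imp_le) simp
  then show "2 \<le> y"
    using assms(2) by (simp add: r_def field_simps)
qed

lemma F_cost_at_21:
  assumes "0 < T" "T \<le> 0.42"
  shows "F_cost (2.1 / T) T \<le> 5.234"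
proof -
  have "(2.1 / T + 1) / (2.1 / T - 1) = (2.1 + T) / (2.1 - T)"
    using assms by (auto simp: divide_simps algebra_simps)
  \<comment> \<open>Equality holds at T = 0.42. The other factor is sqrt (1 + 2.1^2) \<le> 2.326,
    and 1.5^2 * 2.326 = 5.2335 is the source of 5.234.\<close>
  also have "\<dots> \<le> 1.5"
    using assms by (simp add: field_simps)
  finally have "((2.1 / T + 1) / (2.1 / T - 1))\<^sup>2 \<le> 1.5\<^sup>2"
    using assms by (intro power_mono) (auto simp: field_simps)
  moreover have "sqrt (1 + (T * (2.1 / T))\<^sup>2) \<le> 2.326"
    using assms by (intro real_le_lsqrt) (auto simp: power2_eq_square)
  ultimately have "F_cost (2.1 / T) T \<le> 1.5\<^sup>2 * 2.326"
    unfolding F_cost_def by (intro mult_mono) auto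
  then show ?thesis
    by (simp add: power2_eq_square)
qed

lemma continuous_on_F_cost:
  assumes "0 < a" "b < pi" "1 < m"
  shows "continuous_on ({m..M} \<times> {a..b}) (\<lambda>(y, \<phi>). F_cost y (tan (\<phi> / 2)))"
proof -
  have "cos (\<phi> / 2) \<noteq> 0" if "\<phi> \<in> {a..b}" for \<phi>
    using that assms cos_gt_zero[of "\<phi> / 2"] by auto
  then show ?thesis
    unfolding F_cost_def tan_def case_prod_unfold
    using assms(3) by (intro continuous_intros) auto
qed

lemma cal_F_attained:
  assumes "0 < \<phi>" "\<phi> < pi" "tan (\<phi> / 2) \<le> 0.42"
  obtains y where "2 \<le> y" "tan (\<phi> / 2) * y \<le> 5.14" "cal_F \<phi> = F_cost y (tan (\<phi> / 2))"
    "\<And>y'. 1 < y' \<Longrightarrow> cal_F \<phi> \<le> F_cost y' (tan (\<phi> / 2))"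
proof -
  define T where "T = tan (\<phi> / 2)"
  have T: "0 < T" "T \<le> 0.42"
    using assms by (auto simp: T_def tan_half_pos)
  let ?K = "{2..5.14 / T}"
  have y0: "1 < 2.1 / T" "2.1 / T \<in> ?K"
    using T by (auto simp: field_simps)
  have "continuous_on ?K (\<lambda>y. (\<lambda>(y, \<phi>). F_cost y (tan (\<phi> / 2))) (y, \<phi>))"
    using assms by (intro continuous_on_compose2[OF continuous_on_F_cost[of \<phi> \<phi> 2 "5.14 / T"]] continuous_intros) auto
  then have "continuous_on ?K (\<lambda>y. F_cost y T)"
    by (simp add: T_def)
  then obtain y where y: "y \<in> ?K" "\<And>y'. y' \<in> ?K \<Longrightarrow> F_cost y T \<le> F_cost y' T"
    using continuous_attains_inf[of ?K "\<lambda>y. F_cost y T"] y0(2) by auto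
  have min: "F_cost y T \<le> F_cost y' T" if "1 < y'" for y'
  proof (cases "F_cost y' T \<le> 5.234")
    case True
    then have "y' \<in> ?K"
      using F_cost_coercive[OF T(1) that] T by (simp add: field_simps)
    then show ?thesis
      by (rule y(2))
  next
    case False
    then show ?thesis
      using y(2)[OF y0(2)] F_cost_at_21[OF T] by linarith
  qed
  have "cal_F \<phi> = F_cost y T"
    unfolding T_def using assms y(1) min by (intro cal_F_eqI) (auto simp: T_def)
  moreover have "T * y \<le> 5.14"
    using y(1) T by (simp add: field_simps)
  ultimately show ?thesis
    using that[of y] y(1) min by (simp add: T_def)
qed

lemma continuous_on_cal_F:
  assumes "0 < a" "b < pi" "tan (b / 2) \<le> 0.42"
  shows "continuous_on {a..b} cal_F"
proof (rule continuous_on_minimum)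
  \<comment> \<open>The interval found for a single angle has upper end 5.14 / tan (\<phi> / 2); the
    one for the smallest angle a contains all of them.\<close>
  let ?K = "{2..5.14 / tan (a / 2)}"
  show "continuous_on (?K \<times> {a..b}) (\<lambda>(y, \<phi>). F_cost y (tan (\<phi> / 2)))"
    using assms by (intro continuous_on_F_cost) auto
  fix \<phi> assume ab: "\<phi> \<in> {a..b}"
  then have \<phi>: "0 < \<phi>" "\<phi> < pi"
    using assms by auto
  have mono: "tan (x / 2) \<le> tan (z / 2)" if "0 < x" "x \<le> z" "z < pi" for x z
    using that tan_monotone[of "x / 2" "z / 2"] by (cases "x = z") auto
  have "tan (\<phi> / 2) \<le> 0.42"
    using mono[of \<phi> b] ab assms by auto
  note att = cal_F_attained[OF \<phi> this]
  have a: "0 < tan (a / 2)" "tan (a / 2) \<le> tan (\<phi> / 2)"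
    using mono[of a \<phi>] ab assms by (auto intro: tan_half_pos)
  show "\<exists>y\<in>?K. cal_F \<phi> = F_cost y (tan (\<phi> / 2))"
  proof (rule att)
    fix y assume y: "2 \<le> y" "tan (\<phi> / 2) * y \<le> 5.14" "cal_F \<phi> = F_cost y (tan (\<phi> / 2))"
    have "tan (a / 2) * y \<le> tan (\<phi> / 2) * y"
      using a y by (intro mult_right_mono) auto
    then have "tan (a / 2) * y \<le> 5.14"
      using y(2) by linarith
    then have "y \<in> ?K"
      using y(1) a(1) by (simp add: field_simps)
    then show ?thesis
      using y(3) by blast
  qed
  show "cal_F \<phi> \<le> F_cost y (tan (\<phi> / 2))" if "y \<in> ?K" for y
  proof (rule att)
    assume "\<And>y'. 1 < y' \<Longrightarrow> cal_F \<phi> \<le> F_cost y' (tan (\<phi> / 2))"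
    then show ?thesis
      using that by simp
  qed
qed auto

section \<open>The speed ratio gamma and its range\<close>

lemma continuous_on_gamma_fun:
  assumes "0 < a" "b < pi" "tan (b / 2) \<le> 0.42"
  shows "continuous_on {a..b} gamma_fun"
proof -
  have "cal_R \<phi> \<noteq> 0" if "\<phi> \<in> {a..b}" for \<phi>
    using that assms cal_R_pos[of \<phi>] by auto
  then have "continuous_on {a..b} (\<lambda>\<phi>. cos (\<phi> / 2) * cal_F \<phi> / cal_R \<phi>)"
    by (intro continuous_intros continuous_on_cal_F continuous_on_cal_R assms) auto
  then show ?thesis
    by (simp add: gamma_fun_def[abs_def])
qed

text \<open>The competitor y = 1 / sqrt T serves both factors of \<open>F_cost\<close>: y tends to
  infinity, so the quotient tends to 1, while T y = sqrt T tends to 0. With the lower bound for R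
  this bounds gamma by E / U_1, where E tends to 1.\<close>

lemma gamma_fun_small:
  assumes "1 < c * cal_U 1" "0 < b" "b < pi" "tan (b / 2) \<le> 0.42"
  obtains a where "0 < a" "a < b" "gamma_fun a \<le> c"
proof -
  define E where "E \<phi> = ((1 + sqrt (tan (\<phi> / 2))) / (1 - sqrt (tan (\<phi> / 2))))\<^sup>2 * sqrt (1 + tan (\<phi> / 2))
    / (1 - \<phi> / (2 * pi))" for \<phi>
  have "(E \<longlongrightarrow> ((1 + sqrt (tan (0 / 2))) / (1 - sqrt (tan (0 / 2))))\<^sup>2 * sqrt (1 + tan (0 / 2))
    / (1 - 0 / (2 * pi))) (at_right 0)"
    unfolding E_def by (intro tendsto_intros) auto
  then have "(E \<longlongrightarrow> 1) (at_right 0)"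
    by simp
  then have "eventually (\<lambda>\<phi>. E \<phi> < c * cal_U 1) (at_right 0)"
    using assms(1) by (rule order_tendstoD)
  moreover have "eventually (\<lambda>\<phi>. \<phi> \<in> {0<..<b}) (at_right 0)"
    using assms(2) by (rule eventually_at_right_real)
  ultimately obtain \<phi> where \<phi>: "E \<phi> < c * cal_U 1" "0 < \<phi>" "\<phi> < b"
    using eventually_happens[OF eventually_conj] by fastforce
  define T where "T = tan (\<phi> / 2)"
  have "\<phi> < pi"
    using \<phi> assms by simp
  have "T \<le> 0.42"
    using tan_monotone[of "\<phi> / 2" "b / 2"] \<phi> assms by (simp add: T_def)
  have T: "0 < T" "sqrt T < 1"
    using \<phi> \<open>\<phi> < pi\<close> \<open>T \<le> 0.42\<close> by (auto simp: T_def intro: tan_half_pos)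
  have q: "0 < 1 - \<phi> / (2 * pi)"
    using \<phi>(2) \<open>\<phi> < pi\<close> by (simp add: field_simps)
  have "cal_F \<phi> \<le> F_cost (1 / sqrt T) T"
  proof (rule cal_F_attained[OF \<phi>(2) \<open>\<phi> < pi\<close> \<open>T \<le> 0.42\<close>[unfolded T_def]])
    assume "\<And>y'. 1 < y' \<Longrightarrow> cal_F \<phi> \<le> F_cost y' (tan (\<phi> / 2))"
    then show ?thesis
      using T by (simp add: T_def)
  qed
  also have "F_cost (1 / sqrt T) T = ((1 + sqrt T) / (1 - sqrt T))\<^sup>2 * sqrt (1 + T)"
  proof -
    have "(1 / sqrt T + 1) / (1 / sqrt T - 1) = (1 + sqrt T) / (1 - sqrt T)"
      using T by (simp add: divide_simps)
    moreover have "T * (1 / sqrt T) = sqrt T"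
      using T by (simp add: real_div_sqrt)
    ultimately show ?thesis
      using T by (simp add: F_cost_def)
  qed
  also have "\<dots> = E \<phi> * (1 - \<phi> / (2 * pi))"
    using q by (simp add: E_def T_def)
  also have "\<dots> \<le> c * cal_U 1 * (1 - \<phi> / (2 * pi))"
    using q \<phi>(1) by (intro mult_right_mono) auto
  also have "\<dots> = c * ((1 - \<phi> / (2 * pi)) * cal_U 1)"
    by simp
  also have "\<dots> \<le> c * cal_R \<phi>"
  proof (rule mult_left_mono[OF cal_R_ge[OF \<phi>(2) \<open>\<phi> < pi\<close>]])
    show "0 \<le> c"
      using less_trans[OF zero_less_one assms(1)] cal_U_1_pos zero_less_mult_pos2 less_imp_le by blast
  qed
  finally have F: "cal_F \<phi> \<le> c * cal_R \<phi>" .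
  have "0 \<le> cal_F \<phi>"
    by (rule cal_F_attained[OF \<phi>(2) \<open>\<phi> < pi\<close> \<open>T \<le> 0.42\<close>[unfolded T_def]]) (simp add: F_cost_def)
  then have "cos (\<phi> / 2) * cal_F \<phi> \<le> 1 * cal_F \<phi>"
    by (intro mult_right_mono) auto
  then have "gamma_fun \<phi> \<le> c"
    using F cal_R_pos[OF \<phi>(2) \<open>\<phi> < pi\<close>] by (simp add: gamma_fun_def field_simps)
  then show ?thesis
    using that \<phi> by blast
qed

text \<open>The bound must hold for an unknown minimiser y. By Cauchy-Schwarz (1 + 2.1 t)^2 \<le> (1
  + 2.1^2) (1 + t^2) for t = 0.42 y, so the square root gives way to a linear function and a cubic
  inequality in u = t - 0.42 remains.\<close>

lemma gamma_fun_large: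
  assumes "0 < \<phi>" "\<phi> < pi" "tan (\<phi> / 2) = 0.42"
  shows "0.268872 \<le> gamma_fun \<phi>"
proof -
  have le: "tan (\<phi> / 2) \<le> 0.42"
    using assms(3) by simp
  obtain y where y: "2 \<le> y" "cal_F \<phi> = F_cost y 0.42"
    using cal_F_attained[OF assms(1,2) le] unfolding assms(3) by blast
  define u where "u = 0.42 * y - 0.42"
  have u: "0 < u"
    using y by (simp add: u_def)
  have r: "(y + 1) / (y - 1) = (u + 0.84) / u"
    using y by (simp add: u_def field_simps)
  have t: "0.42 * y = u + 0.42"
    by (simp add: u_def)
  have C: "cos (\<phi> / 2) * sqrt 1.1764 = 1"
    using sqrt_one_plus_tan[of "\<phi> / 2"] cos_gt_zero[of "\<phi> / 2"] assms by (simp add: power2_eq_square)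
  have c: "0 < cos (\<phi> / 2)"
    using assms by (intro cos_gt_zero) auto
  \<comment> \<open>Expanding shows that the cubic (u + 0.84)^2 (1 + 2.1 (u + 0.42)) exceeds 11.78
    u^2 by at least this product.\<close>
  have "0 \<le> (2.1 * u + 0.14) * (u - 1.55)\<^sup>2"
    using u by (intro mult_nonneg_nonneg) auto
  then have "11.78 * u\<^sup>2 \<le> (u + 0.84)\<^sup>2 * (1 + 2.1 * (u + 0.42))"
    using u by (simp add: power2_eq_square algebra_simps)
  then have poly: "11.78 \<le> ((u + 0.84) / u)\<^sup>2 * (1 + 2.1 * (u + 0.42))"
    using u by (simp add: power_divide field_simps)
  have scale: "A * (q * s) \<le> k * (q * B)" if "A * s \<le> k * B" "0 < q" for A s k q B :: real
    using mult_left_mono[OF that(1), of q] that(2) by (simp add: algebra_simps)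
  have lin: "1 + 2.1 * (u + 0.42) \<le> 2.523 * (cos (\<phi> / 2) * sqrt (1 + (u + 0.42)\<^sup>2))"
  proof -
    \<comment> \<open>The constants are 5.41 = 1 + 2.1^2 and 1.1764 = 1 + 0.42^2; 2.523 bounds the
      square root of their product.\<close>
    have "(1 + 2.1 * (u + 0.42))\<^sup>2 \<le> 5.41 * (1 + (u + 0.42)\<^sup>2)"
      using zero_le_power2[of "u + 0.42 - 2.1"] by (simp add: power2_eq_square algebra_simps)
    then have "(1 + 2.1 * (u + 0.42))\<^sup>2 * 1.1764 \<le> 5.41 * 1.1764 * (1 + (u + 0.42)\<^sup>2)"
      by simp
    also have "\<dots> \<le> 2.523\<^sup>2 * (1 + (u + 0.42)\<^sup>2)"
      by (intro mult_right_mono) (auto simp: power2_eq_square)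
    finally have "sqrt ((1 + 2.1 * (u + 0.42))\<^sup>2 * 1.1764) \<le> sqrt (2.523\<^sup>2 * (1 + (u + 0.42)\<^sup>2))"
      by (rule real_sqrt_le_mono)
    then have "(1 + 2.1 * (u + 0.42)) * sqrt 1.1764 \<le> 2.523 * sqrt (1 + (u + 0.42)\<^sup>2)"
      using u unfolding real_sqrt_mult real_sqrt_abs by simp
    then have "(1 + 2.1 * (u + 0.42)) * (cos (\<phi> / 2) * sqrt 1.1764) \<le> 2.523 * (cos (\<phi> / 2) * sqrt (1 + (u + 0.42)\<^sup>2))"
      by (rule scale[OF _ c])
    then show ?thesis
      unfolding C by simp
  qed
  have "11.78 \<le> ((u + 0.84) / u)\<^sup>2 * (2.523 * (cos (\<phi> / 2) * sqrt (1 + (u + 0.42)\<^sup>2)))"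
    using poly mult_left_mono[OF lin zero_le_power2[of "(u + 0.84) / u"]] by linarith
  also have "\<dots> = 2.523 * (cos (\<phi> / 2) * cal_F \<phi>)"
    unfolding y(2) F_cost_def r t by simp
  finally have "0.268872 * 17.36 \<le> cos (\<phi> / 2) * cal_F \<phi>"
    by simp
  moreover have "cal_R \<phi> \<le> 17.36"
    using cal_R_less[OF assms(1,2)] cal_U_1_upper by simp
  then have "0.268872 * cal_R \<phi> \<le> 0.268872 * 17.36"
    by (intro mult_left_mono) auto
  ultimately have "0.268872 * cal_R \<phi> \<le> cos (\<phi> / 2) * cal_F \<phi>"
    by (rule order_trans[rotated])
  then show ?thesis
    using cal_R_pos[OF assms(1,2)] by (simp add: gamma_fun_def field_simps)
qed

lemma gamma_fun_attains:
  assumes "0.0578391 < c" "c < 0.268872"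
  obtains \<phi> where "0 < \<phi>" "\<phi> < pi" "tan (\<phi> / 2) \<le> 0.42" "gamma_fun \<phi> = c"
proof -
  define b :: real where "b = 2 * arctan 0.42"
  have b: "0 < b" "b < pi" "tan (b / 2) = 0.42"
    using arctan_ubound[of "0.42"] by (auto simp: b_def tan_arctan)
  have "0.0578391 * cal_U 1 \<le> c * cal_U 1"
    using assms cal_U_1_pos by (intro mult_right_mono) auto
  then have "1 < c * cal_U 1"
    using cal_U_1_lower by linarith
  then obtain a where a: "0 < a" "a < b" "gamma_fun a \<le> c"
    using gamma_fun_small[of c b] b by auto
  have "\<exists>\<phi>\<ge>a. \<phi> \<le> b \<and> gamma_fun \<phi> = c"
  proof (rule IVT')
    show "c \<le> gamma_fun b"
      using gamma_fun_large[OF b] assms by linarith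
    show "continuous_on {a..b} gamma_fun"
      using a b by (intro continuous_on_gamma_fun) auto
  qed (use a in auto)
  then obtain \<phi> where \<phi>: "a \<le> \<phi>" "\<phi> \<le> b" "gamma_fun \<phi> = c"
    by blast
  have "tan (\<phi> / 2) \<le> tan (b / 2)"
    using tan_monotone[of "\<phi> / 2" "b / 2"] \<phi> a b by (cases "\<phi> = b") auto
  then show ?thesis
    using that[of \<phi>] \<phi> a b by auto
qed

section \<open>Trajectories\<close>

text \<open>With \<open>t = tan (\<theta> - \<phi> / 2)\<close>, \<open>T = tan (\<phi> / 2)\<close> and \<open>w\<close> the tangent of the angle between a ray and the
  axis of the cone, this says that a ray inside the cone is searched no later, relative to distance,
  than its boundary. It fails for wide cones; the bounds \<open>T \<le> 0.42\<close> and \<open>t \<le> 5.14\<close> are those of \<open>cal_F_attained\<close>.\<close>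

lemma zigzag_tangent_inequality:
  fixes t w T :: real
  assumes "0 < T" "T \<le> 0.42" "T < t" "t \<le> 5.14" "\<bar>w\<bar> \<le> T"
  shows "(t - w) * (t - T) * sqrt (1 + T\<^sup>2) \<le> (t + w) * (t + T) * sqrt (1 + w\<^sup>2)"
proof -
  have w: "w\<^sup>2 \<le> T\<^sup>2"
    using assms(1,5) abs_le_square_iff[of w T] by simp
  \<comment> \<open>The factorisation 1 + T^2 = (1 + w^2) (1 + z) and sqrt (1 + z) \<le> 1 + z / 2
    remove both square roots, leaving a rational inequality.\<close>
  define z where "z = (T\<^sup>2 - w\<^sup>2) / (1 + w\<^sup>2)"
  have pos: "0 < 1 + w\<^sup>2"
    by (simp add: add_pos_nonneg)
  have z: "0 \<le> z" "(1 + w\<^sup>2) * (1 + z) = 1 + T\<^sup>2"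
    using w pos by (simp_all add: z_def field_simps)
  have "sqrt (1 + z) \<le> 1 + z / 2"
    using z(1) by (intro real_le_lsqrt) (auto simp: power2_eq_square field_simps)
  then have "sqrt (1 + w\<^sup>2) * sqrt (1 + z) \<le> sqrt (1 + w\<^sup>2) * (1 + z / 2)"
    by (intro mult_left_mono) auto
  then have sq: "sqrt (1 + T\<^sup>2) \<le> sqrt (1 + w\<^sup>2) * (1 + z / 2)"
    unfolding z(2)[symmetric] real_sqrt_mult .
  have "(t - w) * (t - T) \<le> t * t"
  proof (cases "0 \<le> w")
    case True
    then have "w * T \<le> t * T" "0 \<le> t * w"
      using assms by (auto intro: mult_right_mono)
    then show ?thesis
      by (simp add: algebra_simps)
  next
    case False
    then have "w * T \<le> 0" "0 \<le> t * (T + w)"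
      using assms by (auto simp: mult_le_0_iff)
    then show ?thesis
      by (simp add: algebra_simps)
  qed
  then have "(t - w) * (t - T) * (T - w) \<le> t * t * (T - w)"
    using assms by (intro mult_right_mono) auto
  also have "\<dots> = t * (t * (T - w))"
    by simp
  also have "\<dots> \<le> t * (4 * (1 + w\<^sup>2))"
  proof (rule mult_left_mono)
    \<comment> \<open>The numerical bounds on t and T enter here; 0.6425 = 5.14 / 8 completes the
      square in w.\<close>
    have "t * (T - w) \<le> 5.14 * (0.42 - w)"
      using assms by (intro mult_mono) auto
    also have "\<dots> \<le> 4 * (1 + w\<^sup>2)"
      using zero_le_power2[of "w + 0.6425"] by (simp add: power2_eq_square algebra_simps)
    finally show "t * (T - w) \<le> 4 * (1 + w\<^sup>2)" .
  qed (use assms in auto)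
  finally have "(t - w) * (t - T) * (T - w) * (T + w) \<le> t * (4 * (1 + w\<^sup>2)) * (T + w)"
    using assms by (intro mult_right_mono) auto
  then have "(t - w) * (t - T) * (T\<^sup>2 - w\<^sup>2) \<le> 4 * t * (T + w) * (1 + w\<^sup>2)"
    by (simp add: power2_eq_square algebra_simps)
  \<comment> \<open>Half of the right-hand side is (t + w) (t + T) - (t - w) (t - T).\<close>
  then have "(t - w) * (t - T) * z \<le> 4 * t * (T + w)"
    using pos unfolding z_def times_divide_eq_right by (simp only: pos_divide_le_eq)
  then have "(t - w) * (t - T) * (1 + z / 2) \<le> (t + w) * (t + T)"
    by (simp add: algebra_simps)
  then have "(t - w) * (t - T) * (1 + z / 2) * sqrt (1 + w\<^sup>2) \<le> (t + w) * (t + T) * sqrt (1 + w\<^sup>2)"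
    by (intro mult_right_mono) auto
  moreover have "(t - w) * (t - T) * sqrt (1 + T\<^sup>2) \<le> (t - w) * (t - T) * (sqrt (1 + w\<^sup>2) * (1 + z / 2))"
    using assms sq by (intro mult_left_mono) auto
  ultimately show ?thesis
    by (simp add: mult_ac)
qed

text \<open>Here \<alpha> and \<beta> are the angles of an inner ray with the two sides of the cone,
  and \<omega> is its deviation from the axis. Sum formulas extract the common factor 2 sin h, and
  passing to t = y tan h and w = tan \<omega> gives the tangent inequality. The two chord directions
  use it with \<alpha> and \<beta> exchanged.\<close>

lemma zigzag_inequality:
  assumes "0 < \<phi>" "\<phi> < pi" "tan (\<phi> / 2) \<le> 0.42" "2 \<le> y" "tan (\<phi> / 2) * y \<le> 5.14"
    and "0 \<le> \<alpha>" "0 \<le> \<beta>" "\<alpha> + \<beta> = \<phi>"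
  defines "\<rho> \<equiv> (y + 1) / (y - 1)"
  shows "(sin \<alpha> + sin \<beta>) * (sin \<beta> + \<rho> * sin \<alpha>) \<le> \<rho> * sin \<phi> * (sin \<alpha> + \<rho> * sin \<beta>)"
proof -
  define h where "h = \<phi> / 2"
  define \<omega> where "\<omega> = (\<beta> - \<alpha>) / 2"
  have ang: "\<alpha> = h - \<omega>" "\<beta> = h + \<omega>" "\<phi> = 2 * h"
    using assms by (simp_all add: h_def \<omega>_def field_simps)
  have h: "0 < h" "h < pi / 2" "\<bar>\<omega>\<bar> \<le> h"
    using assms(1,2,6,7) unfolding ang by auto
  define T t w where "T = tan h" and "t = y * T" and "w = tan \<omega>"
  have c: "0 < cos h" "0 < cos \<omega>" and s: "0 < sin h"
    using h by (auto intro!: cos_gt_zero_pi sin_gt_zero)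
  have sh: "sin h = cos h * T" "sin \<omega> = cos \<omega> * w"
    using c by (simp_all add: T_def w_def tan_def)
  have T: "0 < T" "T \<le> 0.42"
    using assms(1-3) by (auto simp: T_def h_def tan_half_pos)
  have t: "T < t" "t \<le> 5.14"
    using assms(4,5) T by (auto simp: t_def T_def h_def mult.commute)
  have "tan v \<le> tan h" if "\<bar>v\<bar> \<le> h" for v
  proof (cases "v = h")
    case False
    have "- (pi / 2) < v" "v < h"
      using h that False by linarith+
    then show ?thesis
      using tan_monotone[of v h] h(2) by simp
  qed simp
  from this[of \<omega>] this[of "- \<omega>"] have "tan \<omega> \<le> tan h" "tan (- \<omega>) \<le> tan h"
    using h by auto
  then have w: "\<bar>w\<bar> \<le> T"
    by (simp add: w_def T_def)
  have sq: "sqrt (1 + T\<^sup>2) = 1 / cos h" "sqrt (1 + w\<^sup>2) = 1 / cos \<omega>"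
    using c by (simp_all add: T_def w_def sqrt_one_plus_tan)
  have y: "0 < y - 1"
    using assms(4) by simp
  have "(t - w) * (t - T) * (1 / cos h) * (cos h * cos \<omega>) \<le> (t + w) * (t + T) * (1 / cos \<omega>) * (cos h * cos \<omega>)"
    using zigzag_tangent_inequality[OF T t w] c unfolding sq by (intro mult_right_mono) auto
  then have "cos \<omega> * (t - w) * (T * (y - 1)) \<le> cos h * (t + w) * (T * (y + 1))"
    using c by (simp add: t_def algebra_simps)
  then have "cos \<omega> * (t - w) * (y - 1) \<le> cos h * (t + w) * (y + 1)"
    using T(1) by (simp add: mult.left_commute[of _ T])
  then have core: "cos \<omega> * (t - w) \<le> \<rho> * cos h * (t + w)"
    using y by (simp add: \<rho>_def field_simps)
  define k where "k = 2 / (y - 1)"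
  define q where "q = k * (cos h * cos \<omega>)"
  have q: "0 < q"
    using y c by (simp add: q_def k_def)
  have \<rho>: "\<rho> - 1 = k" "\<rho> + 1 = k * y"
    using y by (simp_all add: \<rho>_def k_def field_simps)
  have sums: "sin \<beta> + \<rho> * sin \<alpha> = (\<rho> + 1) * (sin h * cos \<omega>) - (\<rho> - 1) * (cos h * sin \<omega>)"
    "sin \<alpha> + \<rho> * sin \<beta> = (\<rho> + 1) * (sin h * cos \<omega>) + (\<rho> - 1) * (cos h * sin \<omega>)"
    unfolding ang sin_add sin_diff by (simp_all add: algebra_simps)
  have eqs: "sin \<beta> + \<rho> * sin \<alpha> = q * (t - w)" "sin \<alpha> + \<rho> * sin \<beta> = q * (t + w)"
    unfolding sums \<rho> sh q_def t_def by (simp_all add: algebra_simps)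
  have "sin \<alpha> + sin \<beta> = 2 * sin h * cos \<omega>"
    unfolding ang sin_add sin_diff by simp
  moreover have "sin \<phi> = 2 * sin h * cos h"
    unfolding ang by (rule sin_double)
  moreover have "2 * sin h * q * (cos \<omega> * (t - w)) \<le> 2 * sin h * q * (\<rho> * cos h * (t + w))"
    using core s q by (intro mult_left_mono) auto
  ultimately show ?thesis
    unfolding eqs by (simp add: mult_ac)
qed

section \<open>Geometric scales and coordinates in the cone\<close>

lemma geometric_bracket:
  fixes a y \<Lambda> :: real
  assumes "1 < \<Lambda>" "0 < a" "0 < y"
  obtains n where "\<Lambda> powi n * a < y" "y \<le> \<Lambda> powi (n + 1) * a"
proof -
  define n where "n = \<lceil>log \<Lambda> (y / a)\<rceil> - 1"
  have pw: "\<Lambda> powi m = \<Lambda> powr of_int m" for m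
    using assms(1) by (simp add: powr_real_of_int')
  have n: "of_int n < log \<Lambda> (y / a)" "log \<Lambda> (y / a) \<le> of_int (n + 1)"
    unfolding n_def by linarith+
  have "\<Lambda> powr of_int n < y / a"
    using n(1) assms by (simp add: less_log_iff)
  moreover have "y / a \<le> \<Lambda> powr of_int (n + 1)"
    using n(2) assms by (simp only: log_le_iff divide_pos_pos)
  ultimately show ?thesis
    using that[of n] assms(2) unfolding pw by (simp add: field_simps)
qed

lemma powi_ge_self:
  fixes \<Lambda> :: real
  assumes "1 < \<Lambda>" "1 < \<Lambda> powi n"
  shows "\<Lambda> \<le> \<Lambda> powi n"
proof -
  have "0 < n"
  proof (rule ccontr)
    assume "\<not> 0 < n"
    then have "\<Lambda> powi n \<le> \<Lambda> powi 0"
      using assms(1) by (intro power_int_increasing) auto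
    then show False
      using assms(2) by simp
  qed
  then have "\<Lambda> powi 1 \<le> \<Lambda> powi n"
    using assms(1) by (intro power_int_increasing) auto
  then show ?thesis
    by simp
qed

lemma polar_zero [simp]: "polar 0 \<theta> = 0"
  by (simp add: polar_def zero_prod_def)

lemma scaleR_polar [simp]: "r *\<^sub>R polar a \<theta> = polar (r * a) \<theta>"
  by (simp add: polar_def)

lemma norm_polar_diff: "norm (polar a \<alpha> - polar b \<beta>) = sqrt (a\<^sup>2 - 2 * a * b * cos (\<alpha> - \<beta>) + b\<^sup>2)"
proof -
  have "(a * cos \<alpha> - b * cos \<beta>)\<^sup>2 + (a * sin \<alpha> - b * sin \<beta>)\<^sup>2
    = a\<^sup>2 * ((sin \<alpha>)\<^sup>2 + (cos \<alpha>)\<^sup>2) - 2 * a * b * cos (\<alpha> - \<beta>) + b\<^sup>2 * ((sin \<beta>)\<^sup>2 + (cos \<beta>)\<^sup>2)"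
    unfolding cos_diff by algebra
  then show ?thesis
    by (simp add: polar_def norm_Pair)
qed

lemma linepath_derivative:
  fixes a b :: "'a::real_normed_vector"
  shows "(linepath a b has_vector_derivative b - a) (at u)"
  unfolding linepath_def by (auto intro!: derivative_eq_intros simp: algebra_simps)

lemma linepath_real_derivative:
  fixes a b :: real
  shows "b - a = m \<Longrightarrow> (linepath a b has_real_derivative m) (at u)"
  using linepath_derivative[of a b u] by (simp add: has_real_derivative_iff_has_vector_derivative)

text \<open>Since sin \<phi> is positive, all points of the chord have positive second coordinate
  except the end on the ray of angle 0, whose first coordinate is positive. So passages through the
  cone never serve a target on the ray of angle pi.\<close>

lemma not_exposes_pi:
  assumes "0 < sin \<phi>" "0 < r" "0 < b" "0 < a" "0 \<le> u" "u \<le> 1" "0 < y"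
  shows "\<not> exposes (r *\<^sub>R linepath (polar a 0) (polar b \<phi>) u) (polar y pi)"
    "\<not> exposes (r *\<^sub>R linepath (polar b \<phi>) (polar a 0) u) (polar y pi)"
proof -
  have *: "\<not> exposes (r *\<^sub>R (v *\<^sub>R polar a 0 + u *\<^sub>R polar b \<phi>)) (polar y pi)"
    if uv: "0 \<le> u" "0 \<le> v" "u + v = 1" for u v
  proof
    assume "exposes (r *\<^sub>R (v *\<^sub>R polar a 0 + u *\<^sub>R polar b \<phi>)) (polar y pi)"
    then obtain z where z: "y \<le> z" "r *\<^sub>R (v *\<^sub>R polar a 0 + u *\<^sub>R polar b \<phi>) = polar z pi"
      using exposes_polar_iff[OF assms(7)] by blast
    then have e: "r * (u * (b * sin \<phi>)) = 0" "r * (v * a + u * (b * cos \<phi>)) = - z"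
      by (auto simp: polar_def)
    then have "u = 0"
      using assms by simp
    then have "r * a = - z"
      using e uv by simp
    moreover have "0 < r * a"
      using assms by simp
    ultimately show False
      using z assms by linarith
  qed
  show "\<not> exposes (r *\<^sub>R linepath (polar a 0) (polar b \<phi>) u) (polar y pi)"
    using *[of u "1 - u"] assms by (simp add: linepath_def)
  show "\<not> exposes (r *\<^sub>R linepath (polar b \<phi>) (polar a 0) u) (polar y pi)"
    using *[of "1 - u" u] assms by (simp add: linepath_def add.commute)
qed

text \<open>Resolves a vector along the two sides of the cone, which locates the crossing of a chord
  with an inner ray; the factor sin \<phi> avoids a division.\<close>

lemma polar_sector:
  "polar (r * sin \<phi>) \<psi> = polar (r * sin (\<phi> - \<psi>)) 0 + polar (r * sin \<psi>) \<phi>"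
  by (simp add: polar_def sin_diff algebra_simps)

lemma coneE:
  assumes "A \<in> plane_cone \<phi>"
  obtains y \<psi> where "0 < y" "0 \<le> \<psi>" "\<psi> < \<phi>" "A = polar y \<psi>"
  using assms by (auto simp: plane_cone_def ray_def)

lemma conic_complementE:
  assumes "A \<in> conic_complement \<phi>"
  obtains y \<psi> where "0 < y" "\<phi> \<le> \<psi>" "\<psi> < 2 * pi" "A = polar y \<psi>"
proof -
  have A: "A \<in> plane" "A \<notin> plane_cone \<phi>"
    using assms by (auto simp: conic_complement_def)
  obtain y \<psi> where *: "0 < y" "0 \<le> \<psi>" "\<psi> < 2 * pi" "A = polar y \<psi>"
    using A(1) by (rule plane_polarE)
  then have "\<phi> \<le> \<psi>"
    using A(2) by (force simp: plane_cone_def ray_def)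
  then show ?thesis
    using that * by blast
qed

text \<open>One period runs along the spiral from the ray \<phi> to the ray 2 pi, then along a chord
  across the cone to the ray \<phi>, now larger by the factor \<Lambda>. The number r is the radius
  on the ray of angle pi in period 0: a target beyond it has to wait for period 1, which makes the
  cost exact.\<close>

lemma complement_curve:
  fixes s \<phi> :: real
  assumes "0 < s" "0 < \<phi>" "\<phi> < pi"
  obtains \<tau> l r where "arc_length \<tau> l" "0 < r"
    "\<And>A. A \<in> conic_complement \<phi> \<Longrightarrow> \<exists>t. exposes (\<tau> t) A \<and> l t \<le> R_cost s \<phi> * norm A"
    "\<And>x t. 1 < x \<Longrightarrow> exposes (\<tau> t) (polar (x * r) pi) \<Longrightarrow> R_cost s \<phi> * r \<le> l t"
proof -
  define w where "w = 2 * pi - \<phi>"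
  define K where "K = sqrt (1 + s\<^sup>2) / s"
  define E where "E = exp (s * w)"
  define \<Lambda> where "\<Lambda> = jump s \<phi> * E"
  have w: "0 < w" "pi - \<phi> < w"
    using assms by (auto simp: w_def)
  have K: "0 < K"
    using assms by (simp add: K_def add_pos_nonneg)
  have l: "1 < jump s \<phi>"
    using assms by (rule jump_gt_1)
  have E: "1 < E"
    using assms w by (simp add: E_def)
  have \<Lambda>: "1 < \<Lambda>"
    unfolding \<Lambda>_def using l E by (rule less_1_mult)
  have cost: "R_cost s \<phi> = K * \<Lambda>"
    by (simp add: R_cost_def K_def \<Lambda>_def E_def w_def)
  define p where "p u = polar (1 * exp (s * (w * u))) (w * u + \<phi>)" for u
  define x where "x u = K * (1 * exp (s * (w * u)))" for u
  define q where "q = linepath (polar E 0) (polar \<Lambda> \<phi>)"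
  define y where "y = linepath (K * E) (K * \<Lambda>)"
  note deriv = spiral_derivative[OF zero_less_one assms(1) w(1), where \<beta> = \<phi>, folded K_def]
  obtain p' where p': "\<And>u. (p has_vector_derivative p' u) (at u)" "\<And>u. (x has_real_derivative norm (p' u)) (at u)"
  proof -
    have "\<forall>u. \<exists>D. (p has_vector_derivative D) (at u) \<and> (x has_real_derivative norm D) (at u)"
      unfolding p_def x_def using deriv by blast
    then show ?thesis
      using that by metis
  qed
  have chord: "K * \<Lambda> - K * E = norm (polar \<Lambda> \<phi> - polar E 0)"
  proof -
    have "polar \<Lambda> \<phi> - polar E 0 = E *\<^sub>R (polar (jump s \<phi>) \<phi> - polar 1 0)"
      by (simp add: scaleR_diff_right \<Lambda>_def mult.commute)
    then have "norm (polar \<Lambda> \<phi> - polar E 0) = E * norm (polar (jump s \<phi>) \<phi> - polar 1 0)"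
      using E by simp
    also have "norm (polar (jump s \<phi>) \<phi> - polar 1 0) = (jump s \<phi> - 1) * K"
      unfolding norm_polar_diff using jump_chord(2)[OF assms] by (simp add: K_def)
    finally show ?thesis
      by (simp add: \<Lambda>_def algebra_simps)
  qed
  have p1: "p 1 = polar E 0"
    using polar_shift[of E 0 1] by (simp add: p_def E_def w_def)
  interpret two_piece_curve \<Lambda> p q p' "\<lambda>_. polar \<Lambda> \<phi> - polar E 0" x y
  proof
    show "(y has_real_derivative norm (polar \<Lambda> \<phi> - polar E 0)) (at u)" for u
      unfolding y_def using chord by (rule linepath_real_derivative)
    show "(q has_vector_derivative polar \<Lambda> \<phi> - polar E 0) (at u)" for u
      unfolding q_def by (rule linepath_derivative)
    show "q 0 = p 1"
      unfolding p1 q_def by (simp add: linepath_def)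
    show "q 1 = \<Lambda> *\<^sub>R p 0" "y 0 = x 1" "y 1 = \<Lambda> * x 0"
      by (simp_all add: q_def y_def x_def p_def linepath_def E_def)
  qed (use \<Lambda> p' in auto)
  have \<Lambda>n: "0 < \<Lambda> powi n" for n
    using \<Lambda> by simp
  show ?thesis
  proof (rule that[OF arc_length_curve])
    show "0 < exp (s * (pi - \<phi>))"
      by simp
  next
    fix A assume "A \<in> conic_complement \<phi>"
    then obtain z \<psi> where z: "0 < z" "\<phi> \<le> \<psi>" "\<psi> < 2 * pi" and A: "A = polar z \<psi>"
      by (rule conic_complementE)
    define u where "u = (\<psi> - \<phi>) / w"
    have u: "0 \<le> u" "u \<le> 1" "w * u = \<psi> - \<phi>"
      using z w by (auto simp: u_def w_def)
    define a where "a = exp (s * (w * u))"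
    have a: "0 < a"
      by (simp add: a_def)
    obtain n where n: "\<Lambda> powi n * a < z" "z \<le> \<Lambda> powi (n + 1) * a"
      using geometric_bracket[OF \<Lambda> a z(1)] .
    \<comment> \<open>Period n + 1 is the first whose arc reaches distance z on this ray. The radius
      in period n is below z, and one period multiplies the length by \<Lambda>.\<close>
    let ?t = "of_int (n + 1) + u / 2"
    have "curve ?t = polar (\<Lambda> powi (n + 1) * a) \<psi>"
      unfolding first_piece[OF u(1,2)] using u(3) by (simp add: p_def a_def)
    then have "exposes (curve ?t) A"
      using n(2) z(1) unfolding A by (auto simp: exposes_polar_iff)
    moreover have "len ?t = K * \<Lambda> * (\<Lambda> powi n * a)"
      unfolding first_piece[OF u(1,2)] using \<Lambda> by (simp add: x_def a_def power_int_add)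
    moreover have "K * \<Lambda> * (\<Lambda> powi n * a) \<le> K * \<Lambda> * z"
      using n K \<Lambda> by (intro mult_left_mono) auto
    ultimately show "\<exists>t. exposes (curve t) A \<and> len t \<le> R_cost s \<phi> * norm A"
      using z(1) by (auto simp: A cost)
  next
    fix v t
    let ?r = "exp (s * (pi - \<phi>))"
    assume v: "1 < v" and ex: "exposes (curve t) (polar (v * ?r) pi)"
    have vr: "0 < v * ?r"
      using v by simp
    show "R_cost s \<phi> * ?r \<le> len t"
    proof (cases t rule: parameter_cases)
      case (1 n u)
      have "exposes (polar (\<Lambda> powi n * exp (s * (w * u))) (w * u + \<phi>)) (polar (v * ?r) pi)"
        using ex unfolding 1(3) first_piece[OF 1(1,2)] by (simp add: p_def)
      then obtain j :: int where j: "v * ?r \<le> \<Lambda> powi n * exp (s * (w * u))" "w * u + \<phi> = pi + 2 * pi * of_int j"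
        using exposes_polar_polar_iff[OF _ vr] \<Lambda>n by (metis exp_gt_zero mult_pos_pos)
      have "0 \<le> w * u" "w * u \<le> w"
        using 1 w by (auto simp: mult_left_le)
      \<comment> \<open>The arc covers only the angles from \<phi> to 2 pi, so it meets the ray of
        angle pi once per period.\<close>
      then have "- pi < 2 * pi * of_int j" "2 * pi * of_int j < 2 * pi"
        using j(2) assms w_def by linarith+
      then have "- pi * 1 < pi * (2 * of_int j)" "2 * pi * of_int j < 2 * pi * 1"
        by simp_all
      then have "- 1 < (2 :: real) * of_int j" "of_int j < (1 :: real)"
        unfolding mult_minus_left mult_minus_right[symmetric] by (simp_all only: mult_less_cancel_left_pos pi_gt_zero mult_pos_pos zero_less_numeral)
      then have "j = 0"
        by linarith
      then have wu: "w * u = pi - \<phi>"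
        using j(2) by simp
      then have "1 < \<Lambda> powi n"
        using j(1) v less_le_trans[of "1 * ?r" "v * ?r" "\<Lambda> powi n * ?r"] by simp
      then have "K * \<Lambda> * ?r \<le> K * \<Lambda> powi n * ?r"
        using powi_ge_self[OF \<Lambda>] K by (intro mult_right_mono mult_left_mono) auto
      then show ?thesis
        unfolding 1(3) first_piece[OF 1(1,2)] by (simp only: x_def wu cost) (simp add: mult_ac)
    next
      case (2 n u)
      have "0 < sin \<phi>"
        using assms by (intro sin_gt_zero)
      then have "\<not> exposes (\<Lambda> powi n *\<^sub>R q u) (polar (v * ?r) pi)"
        unfolding q_def by (rule not_exposes_pi(1)) (use 2 \<Lambda>n \<Lambda> E vr in auto)
      then show ?thesis
        using ex unfolding 2(3) second_piece[OF 2(1,2)] by simp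
    qed
  qed
qed

text \<open>Each chord multiplies the radius by \<rho>, so the length at a turning point is L times
  its radius, L being the ratio of chord to gain of radius. On an inner ray the crossings alternate
  between r1 and r2, up to powers of \<rho>^2. A target just beyond one crossing is exposed at the
  next, and both comparisons are instances of \<open>zigzag_inequality\<close>.\<close>

lemma zigzag_curve:
  assumes "0 < \<phi>" "\<phi> < pi" "tan (\<phi> / 2) \<le> 0.42" "2 \<le> y" "tan (\<phi> / 2) * y \<le> 5.14"
  obtains \<tau> l where "arc_length \<tau> l"
    "\<And>A. A \<in> plane_cone \<phi> \<Longrightarrow> \<exists>t. exposes (\<tau> t) A \<and> l t \<le> cos (\<phi> / 2) * F_cost y (tan (\<phi> / 2)) * norm A"
    "\<And>t z. 0 < z \<Longrightarrow> \<not> exposes (\<tau> t) (polar z pi)"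
proof -
  define \<rho> where "\<rho> = (y + 1) / (y - 1)"
  define L where "L = sqrt (\<rho>\<^sup>2 - 2 * \<rho> * cos \<phi> + 1) / (\<rho> - 1)"
  have \<rho>: "1 < \<rho>"
    using assms(4) by (simp add: \<rho>_def field_simps)
  then have \<Lambda>: "1 < \<rho>\<^sup>2"
    by (intro one_less_power) auto
  have ch: "0 < cos (\<phi> / 2)"
    using assms by (intro cos_gt_zero) auto
  have L: "L = cos (\<phi> / 2) * sqrt (1 + (tan (\<phi> / 2) * y)\<^sup>2)"
  proof -
    \<comment> \<open>The map taking y to (y + 1) / (y - 1) is an involution.\<close>
    have y: "y = (\<rho> + 1) / (\<rho> - 1)"
      using assms(4) by (simp add: \<rho>_def field_simps)
    have sn: "cos (\<phi> / 2) * tan (\<phi> / 2) = sin (\<phi> / 2)"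
      using ch by (simp add: tan_def)
    have "(cos (\<phi> / 2) * (\<rho> - 1))\<^sup>2 * (1 + (tan (\<phi> / 2) * y)\<^sup>2)
      = (cos (\<phi> / 2) * (\<rho> - 1))\<^sup>2 + ((cos (\<phi> / 2) * tan (\<phi> / 2)) * (y * (\<rho> - 1)))\<^sup>2"
      by (simp add: power2_eq_square algebra_simps)
    also have "y * (\<rho> - 1) = \<rho> + 1"
      using \<rho> by (simp add: y)
    also have "(cos (\<phi> / 2) * (\<rho> - 1))\<^sup>2 + ((cos (\<phi> / 2) * tan (\<phi> / 2)) * (\<rho> + 1))\<^sup>2 = \<rho>\<^sup>2 - 2 * \<rho> * cos \<phi> + 1"
    proof -
      have "cos \<phi> = (cos (\<phi> / 2))\<^sup>2 - (sin (\<phi> / 2))\<^sup>2"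
        using cos_double[of "\<phi> / 2"] by simp
      moreover have "(sin (\<phi> / 2))\<^sup>2 + (cos (\<phi> / 2))\<^sup>2 = 1"
        by simp
      ultimately show ?thesis
        unfolding sn by algebra
    qed
    finally have "sqrt (\<rho>\<^sup>2 - 2 * \<rho> * cos \<phi> + 1) = sqrt ((cos (\<phi> / 2) * (\<rho> - 1))\<^sup>2 * (1 + (tan (\<phi> / 2) * y)\<^sup>2))"
      by simp
    then have "sqrt (\<rho>\<^sup>2 - 2 * \<rho> * cos \<phi> + 1) = cos (\<phi> / 2) * (\<rho> - 1) * sqrt (1 + (tan (\<phi> / 2) * y)\<^sup>2)"
      using ch \<rho> unfolding real_sqrt_mult real_sqrt_abs by simp
    then show ?thesis
      using \<rho> by (simp add: L_def)
  qed
  have cost: "cos (\<phi> / 2) * F_cost y (tan (\<phi> / 2)) = L * \<rho>\<^sup>2"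
    unfolding L F_cost_def \<rho>_def by (simp add: mult_ac)
  have Lpos: "0 < L"
    unfolding L using ch by (simp add: add_pos_nonneg)
  have chord: "norm (polar \<rho> \<phi> - polar 1 0) = L * (\<rho> - 1)" "norm (polar 1 0 - polar \<rho> \<phi>) = L * (\<rho> - 1)"
    "norm (polar \<rho> 0 - polar 1 \<phi>) = L * (\<rho> - 1)"
  proof -
    have "L * (\<rho> - 1) = sqrt (\<rho>\<^sup>2 - 2 * \<rho> * cos \<phi> + 1)"
      using \<rho> by (simp add: L_def)
    then show "norm (polar \<rho> \<phi> - polar 1 0) = L * (\<rho> - 1)" "norm (polar 1 0 - polar \<rho> \<phi>) = L * (\<rho> - 1)"
      "norm (polar \<rho> 0 - polar 1 \<phi>) = L * (\<rho> - 1)"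
      unfolding norm_polar_diff by (simp_all add: algebra_simps)
  qed
  define p where "p = linepath (polar 1 0) (polar \<rho> \<phi>)"
  define q where "q = linepath (polar \<rho> \<phi>) (polar (\<rho>\<^sup>2) 0)"
  define x where "x = linepath L (L * \<rho>)"
  define y' where "y' = linepath (L * \<rho>) (L * \<rho>\<^sup>2)"
  have chord2: "norm (polar (\<rho>\<^sup>2) 0 - polar \<rho> \<phi>) = L * \<rho>\<^sup>2 - L * \<rho>"
  proof -
    have "polar (\<rho>\<^sup>2) 0 - polar \<rho> \<phi> = \<rho> *\<^sub>R (polar \<rho> 0 - polar 1 \<phi>)"
      by (simp add: scaleR_diff_right power2_eq_square)
    then have "norm (polar (\<rho>\<^sup>2) 0 - polar \<rho> \<phi>) = \<rho> * norm (polar \<rho> 0 - polar 1 \<phi>)"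
      using \<rho> by simp
    then show ?thesis
      unfolding chord(3) by (simp add: power2_eq_square algebra_simps)
  qed
  interpret two_piece_curve "\<rho>\<^sup>2" p q "\<lambda>_. polar \<rho> \<phi> - polar 1 0" "\<lambda>_. polar (\<rho>\<^sup>2) 0 - polar \<rho> \<phi>" x y'
  proof
    show "(x has_real_derivative norm (polar \<rho> \<phi> - polar 1 0)) (at u)" for u
      unfolding x_def chord by (rule linepath_real_derivative) (simp add: algebra_simps)
    show "(y' has_real_derivative norm (polar (\<rho>\<^sup>2) 0 - polar \<rho> \<phi>)) (at u)" for u
      unfolding y'_def chord2 by (rule linepath_real_derivative) simp
    show "(p has_vector_derivative polar \<rho> \<phi> - polar 1 0) (at u)"
      "(q has_vector_derivative polar (\<rho>\<^sup>2) 0 - polar \<rho> \<phi>) (at u)" for u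
      unfolding p_def q_def by (rule linepath_derivative)+
    show "q 0 = p 1" "q 1 = \<rho>\<^sup>2 *\<^sub>R p 0" "y' 0 = x 1" "y' 1 = \<rho>\<^sup>2 * x 0"
      by (simp_all add: q_def p_def x_def y'_def linepath_def)
  qed (rule \<Lambda>)
  have \<Lambda>n: "0 < \<rho>\<^sup>2 powi n" for n
    using \<rho> by simp
  show ?thesis
  proof (rule that[OF arc_length_curve])
    fix A assume "A \<in> plane_cone \<phi>"
    then obtain z \<psi> where z: "0 < z" "0 \<le> \<psi>" "\<psi> < \<phi>" and A: "A = polar z \<psi>"
      by (rule coneE)
    define a b where "a = sin (\<phi> - \<psi>)" and "b = sin \<psi>"
    have ab: "0 < a" "0 \<le> b"
      using z assms by (auto simp: a_def b_def intro: sin_gt_zero sin_ge_zero)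
    have d: "0 < b + \<rho> * a" "0 < a + \<rho> * b"
      using ab \<rho> by (auto intro: add_nonneg_pos add_pos_nonneg)
    have sec: "polar (r * sin \<phi>) \<psi> = polar (r * a) 0 + polar (r * b) \<phi>" for r
      unfolding a_def b_def by (rule polar_sector)
    have sphi: "0 < sin \<phi>"
      using assms by (intro sin_gt_zero) auto
    have ineq: "(a + b) * (b + \<rho> * a) \<le> \<rho> * sin \<phi> * (a + \<rho> * b)"
      "(b + a) * (a + \<rho> * b) \<le> \<rho> * sin \<phi> * (b + \<rho> * a)"
      using zigzag_inequality[OF assms, of "\<phi> - \<psi>" \<psi>] zigzag_inequality[OF assms, of \<psi> "\<phi> - \<psi>"] z
      by (auto simp: a_def b_def \<rho>_def)
    \<comment> \<open>The pairs u1, r1 and u2, r2 are the parameters and radii at which the chords p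
      and q cross the ray \<psi>.\<close>
    define u1 r1 where "u1 = b / (b + \<rho> * a)" and "r1 = \<rho> / (b + \<rho> * a) * sin \<phi>"
    have u1: "0 \<le> u1" "u1 \<le> 1" "1 - u1 = \<rho> * a / (b + \<rho> * a)"
      using ab \<rho> d by (auto simp: u1_def field_simps)
    have p: "p u1 = polar r1 \<psi>"
      unfolding p_def linepath_def u1(3) r1_def sec by (simp add: u1_def mult.commute)
    have x: "x u1 = L * (\<rho> * (a + b) / (b + \<rho> * a))"
      unfolding x_def linepath_def u1(3) by (simp add: u1_def add_divide_distrib distrib_left mult_ac)
    define u2 r2 where "u2 = a / (a + \<rho> * b)" and "r2 = \<rho>\<^sup>2 / (a + \<rho> * b) * sin \<phi>"
    have u2: "0 \<le> u2" "u2 \<le> 1" "1 - u2 = \<rho> * b / (a + \<rho> * b)"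
      using ab \<rho> d by (auto simp: u2_def field_simps)
    have q: "q u2 = polar r2 \<psi>"
      unfolding q_def linepath_def u2(3) r2_def sec by (simp add: u2_def add.commute power2_eq_square mult_ac)
    have y': "y' u2 = L * (\<rho>\<^sup>2 * (a + b) / (a + \<rho> * b))"
      unfolding y'_def linepath_def u2(3) by (simp add: u2_def power2_eq_square add_divide_distrib distrib_left mult_ac)
    have r: "0 < r1" "0 < r2"
      using \<rho> d sphi by (auto simp: r1_def r2_def)
    have "\<rho>\<^sup>2 * ((a + b) / (a + \<rho> * b)) \<le> \<rho>\<^sup>2 * (\<rho> * sin \<phi> / (b + \<rho> * a))"
      using ineq(1) d by (intro mult_left_mono) (auto simp: field_simps)
    then have "L * (\<rho>\<^sup>2 * ((a + b) / (a + \<rho> * b))) \<le> L * (\<rho>\<^sup>2 * (\<rho> * sin \<phi> / (b + \<rho> * a)))"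
      by (rule mult_left_mono) (use Lpos in simp)
    \<comment> \<open>I1 covers targets just beyond r1, exposed at the crossing with q; I2 covers
      those just beyond r2, exposed at the crossing with p one period later.\<close>
    then have I1: "y' u2 \<le> L * \<rho>\<^sup>2 * r1"
      unfolding y' r1_def by (simp add: mult_ac)
    have "\<rho> ^ 3 * ((a + b) / (b + \<rho> * a)) \<le> \<rho> ^ 3 * (\<rho> * sin \<phi> / (a + \<rho> * b))"
      using ineq(2) d \<rho> by (intro mult_left_mono) (auto simp: field_simps)
    then have "L * (\<rho> ^ 3 * ((a + b) / (b + \<rho> * a))) \<le> L * (\<rho> ^ 3 * (\<rho> * sin \<phi> / (a + \<rho> * b)))"
      by (rule mult_left_mono) (use Lpos in simp)
    then have I2: "\<rho>\<^sup>2 * x u1 \<le> L * \<rho>\<^sup>2 * r2"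
      unfolding x r2_def by (simp add: power2_eq_square power3_eq_cube mult_ac)
    obtain n where n: "\<rho>\<^sup>2 powi n * r1 < z" "z \<le> \<rho>\<^sup>2 powi (n + 1) * r1"
      using geometric_bracket[OF \<Lambda> r(1) z(1)] .
    have "\<exists>t. exposes (curve t) A \<and> len t \<le> L * \<rho>\<^sup>2 * z"
    proof (cases "z \<le> \<rho>\<^sup>2 powi n * r2")
      case True
      let ?t = "of_int n + (u2 + 1) / 2"
      have "curve ?t = polar (\<rho>\<^sup>2 powi n * r2) \<psi>"
        unfolding second_piece[OF u2(1,2)] q by simp
      then have "exposes (curve ?t) A"
        using True z(1) unfolding A by (auto simp: exposes_polar_iff)
      moreover have "len ?t \<le> \<rho>\<^sup>2 powi n * (L * \<rho>\<^sup>2 * r1)"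
        unfolding second_piece[OF u2(1,2)] using I1 less_imp_le[OF \<Lambda>n] by (rule mult_left_mono)
      moreover have "L * \<rho>\<^sup>2 * (\<rho>\<^sup>2 powi n * r1) \<le> L * \<rho>\<^sup>2 * z"
        using n Lpos by (intro mult_left_mono) auto
      then have "\<rho>\<^sup>2 powi n * (L * \<rho>\<^sup>2 * r1) \<le> L * \<rho>\<^sup>2 * z"
        by (simp add: mult_ac)
      ultimately show ?thesis
        by (meson order_trans)
    next
      case False
      let ?t = "of_int (n + 1) + u1 / 2"
      have "curve ?t = polar (\<rho>\<^sup>2 powi (n + 1) * r1) \<psi>"
        unfolding first_piece[OF u1(1,2)] p by simp
      then have "exposes (curve ?t) A"
        using n(2) z(1) unfolding A by (auto simp: exposes_polar_iff)
      moreover have "len ?t = \<rho>\<^sup>2 powi n * (\<rho>\<^sup>2 * x u1)"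
        unfolding first_piece[OF u1(1,2)] using \<rho> by (simp add: power_int_add)
      then have "len ?t \<le> \<rho>\<^sup>2 powi n * (L * \<rho>\<^sup>2 * r2)"
        using mult_left_mono[OF I2 less_imp_le[OF \<Lambda>n]] by simp
      moreover have "L * \<rho>\<^sup>2 * (\<rho>\<^sup>2 powi n * r2) \<le> L * \<rho>\<^sup>2 * z"
        using False Lpos by (intro mult_left_mono) auto
      then have "\<rho>\<^sup>2 powi n * (L * \<rho>\<^sup>2 * r2) \<le> L * \<rho>\<^sup>2 * z"
        by (simp add: mult_ac)
      ultimately show ?thesis
        by (meson order_trans)
    qed
    then show "\<exists>t. exposes (curve t) A \<and> len t \<le> cos (\<phi> / 2) * F_cost y (tan (\<phi> / 2)) * norm A"
      using z(1) by (simp add: A cost)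
  next
    fix t z :: real
    assume z: "0 < z"
    have s: "0 < sin \<phi>"
      using assms by (intro sin_gt_zero) auto
    show "\<not> exposes (curve t) (polar z pi)"
    proof (cases t rule: parameter_cases)
      case (1 n u)
      have "\<not> exposes (\<rho>\<^sup>2 powi n *\<^sub>R p u) (polar z pi)"
        unfolding p_def by (rule not_exposes_pi(1)) (use 1 \<Lambda>n \<rho> s z in auto)
      then show ?thesis
        unfolding 1(3) first_piece[OF 1(1,2)] .
    next
      case (2 n u)
      have "\<not> exposes (\<rho>\<^sup>2 powi n *\<^sub>R q u) (polar z pi)"
        unfolding q_def by (rule not_exposes_pi(2)) (use 2 \<Lambda>n \<rho> s z in auto)
      then show ?thesis
        unfolding 2(3) second_piece[OF 2(1,2)] .
    qed
  qed
qed

section \<open>The strategies\<close>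

lemma solution_with_costI:
  assumes S: "0 \<le> S" "0 < r"
    and curves: "\<And>i. i < length cs \<Longrightarrow> arc_length (\<tau> i) (l i) \<and> 0 < cs ! i"
    and upper: "\<And>A. A \<in> D \<Longrightarrow> \<exists>i<length cs. \<exists>t. exposes (\<tau> i t) A \<and> l i t \<le> S * cs ! i * norm A"
    and lower: "\<And>x. 1 < x \<Longrightarrow> \<exists>A\<in>D. norm A = x * r \<and>
      (\<forall>i<length cs. \<forall>t. exposes (\<tau> i t) A \<longrightarrow> S * cs ! i * r \<le> l i t)"
  shows "solution_with_cost D cs \<tau> S"
proof -
  have *: "search_curve (\<tau> i)" "path_len (\<tau> i) t = ennreal (l i t)" "0 < cs ! i" if "i < length cs" for i t
    using curves[OF that] by (auto simp: arc_length_def)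
  have "search_cost D cs \<tau> \<le> ennreal S"
  proof (rule search_cost_le[OF S(1)])
    fix A assume "A \<in> D"
    then obtain i t where "i < length cs" "exposes (\<tau> i t) A" "l i t \<le> S * cs ! i * norm A"
      using upper by blast
    then show "\<exists>i<length cs. search_curve (\<tau> i) \<and> 0 < cs ! i \<and>
        (\<exists>t. exposes (\<tau> i t) A \<and> path_len (\<tau> i) t \<le> ennreal (S * cs ! i * norm A))"
      using * by (auto intro!: exI[of _ i] exI[of _ t] ennreal_leI)
  qed
  moreover have "ennreal S \<le> search_cost D cs \<tau>"
  proof (rule search_cost_ge[OF S])
    fix x :: real assume "1 < x"
    from lower[OF this] obtain A where A: "A \<in> D" "norm A = x * r"
      and late: "\<And>i t. i < length cs \<Longrightarrow> exposes (\<tau> i t) A \<Longrightarrow> S * cs ! i * r \<le> l i t"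
      by blast
    then show "\<exists>A\<in>D. norm A = x * r \<and>
        (\<forall>i<length cs. \<forall>t. exposes (\<tau> i t) A \<longrightarrow> ennreal (S * cs ! i * r) \<le> path_len (\<tau> i) t)"
      using * by (auto intro!: bexI[OF _ A(1)] ennreal_leI)
  qed (use * in auto)
  moreover have "feasible D (length cs) \<tau>"
    unfolding feasible_def using *(1) upper by blast
  ultimately show ?thesis
    by (simp add: solution_with_cost_def)
qed

lemma less_two_cases: "i < length [a, b] \<Longrightarrow> i = 0 \<or> i = 1"
  by auto

lemma spiral_bracket:
  fixes k \<psi> y :: real
  assumes "0 < k" "0 < y"
  obtains j :: int where "exp (k * (\<psi> + 2 * pi * of_int j)) < y" "y \<le> exp (k * (\<psi> + 2 * pi * of_int j + 2 * pi))"
proof -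
  have e: "exp (k * (2 * pi)) powi j * exp (k * \<psi>) = exp (k * (\<psi> + 2 * pi * of_int j))" for j
    by (simp add: exp_power_int algebra_simps flip: exp_add)
  have "1 < exp (k * (2 * pi))"
    using assms(1) by simp
  then obtain j where "exp (k * (2 * pi)) powi j * exp (k * \<psi>) < y" "y \<le> exp (k * (2 * pi)) powi (j + 1) * exp (k * \<psi>)"
    using geometric_bracket[of "exp (k * (2 * pi))" "exp (k * \<psi>)" y] assms by auto
  then show ?thesis
    using that[of j] unfolding e by (simp add: algebra_simps)
qed

lemma arc_length_zero: "arc_length (\<lambda>_. 0) (\<lambda>_. 0)"
  by (rule arc_lengthI[where N = "{}" and D = "\<lambda>_. 0"]) auto

lemma not_exposes_zero: "\<not> exposes 0 A"
  by (metis abs_of_pos exposes_def less_irrefl norm_polar norm_zero)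

lemma single_spiral:
  assumes "0 < c"
  shows "\<exists>\<tau>. solution_with_cost plane [1, c] \<tau> (cal_U 1)"
proof -
  define k where "k = kappa 1"
  define K where "K = sqrt (1 + k\<^sup>2) / k"
  have k: "0 < k"
    using kappa(1)[of 1] by (simp add: k_def)
  have K: "0 < K"
    using k by (simp add: K_def add_pos_nonneg)
  have U: "cal_U 1 = K * exp (k * (2 * pi))"
    by (simp add: cal_U_def k_def K_def mult_ac)
  define \<tau> where "\<tau> i = (if i = 0 then (\<lambda>t. polar (1 * exp (k * t)) (t + 0)) else (\<lambda>_. 0))" for i :: nat
  define l where "l i = (if i = 0 then (\<lambda>t. K * (1 * exp (k * t))) else (\<lambda>_. 0))" for i :: nat
  have "solution_with_cost plane [1, c] \<tau> (cal_U 1)"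
  proof (rule solution_with_costI[where r = 1 and l = l])
    show "arc_length (\<tau> i) (l i) \<and> 0 < [1, c] ! i" if "i < length [1, c]" for i
      using less_two_cases[OF that] arc_length_spiral[OF zero_less_one k, of 0, folded K_def] arc_length_zero assms
      unfolding \<tau>_def l_def by (elim disjE) simp_all
  next
    fix A assume "A \<in> plane"
    then obtain y \<psi> where y: "0 < y" and A: "A = polar y \<psi>"
      by (rule plane_polarE)
    obtain j :: int where j: "exp (k * (\<psi> + 2 * pi * of_int j)) < y" "y \<le> exp (k * (\<psi> + 2 * pi * of_int j + 2 * pi))"
      using spiral_bracket[OF k y] .
    let ?t = "\<psi> + 2 * pi * of_int j + 2 * pi"
    have "?t = \<psi> + 2 * pi * of_int (j + 1)"
      by (simp add: algebra_simps)
    then have "exposes (\<tau> 0 ?t) A"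
      unfolding A \<tau>_def using j(2) y by (auto simp: exposes_polar_polar_iff intro!: exI[of _ "j + 1"])
    moreover have "l 0 ?t = cal_U 1 * exp (k * (\<psi> + 2 * pi * of_int j))"
      unfolding U by (simp add: l_def distrib_left exp_add)
    moreover have "cal_U 1 * exp (k * (\<psi> + 2 * pi * of_int j)) \<le> cal_U 1 * y"
      using j(1) cal_U_1_pos by (intro mult_left_mono) auto
    ultimately show "\<exists>i<length [1, c]. \<exists>t. exposes (\<tau> i t) A \<and> l i t \<le> cal_U 1 * [1, c] ! i * norm A"
      using y by (intro exI[of _ 0] conjI exI[of _ ?t]) (simp_all add: A)
  next
    fix x :: real assume x: "1 < x"
    \<comment> \<open>At t = 0 the spiral meets the ray of angle 0 at radius 1 < x, so the target is
      exposed only after a full turn.\<close>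
    have "cal_U 1 \<le> l 0 t" if ex: "exposes (\<tau> 0 t) (polar x 0)" for t
    proof -
      obtain j :: int where j: "x \<le> exp (k * t)" "t = 2 * pi * of_int j"
        using ex x by (auto simp: \<tau>_def exposes_polar_polar_iff)
      then have "1 < exp (k * t)"
        using x by linarith
      then have "0 < t"
        using k by (simp add: zero_less_mult_iff)
      then have "1 \<le> j"
        unfolding j(2) by (simp add: zero_less_mult_iff)
      then have "2 * pi * 1 \<le> 2 * pi * of_int j"
        by (intro mult_left_mono) auto
      then show ?thesis
        unfolding U using j(2) k K by (simp add: l_def)
    qed
    then show "\<exists>A\<in>plane. norm A = x * 1 \<and>
        (\<forall>i<length [1, c]. \<forall>t. exposes (\<tau> i t) A \<longrightarrow> cal_U 1 * [1, c] ! i * 1 \<le> l i t)"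
      using x not_exposes_zero by (intro bexI[of _ "polar x 0"]) (auto simp: less_Suc_eq \<tau>_def polar_in_plane)
  qed (use cal_U_1_pos in auto)
  then show ?thesis
    by blast
qed

text \<open>The third hypothesis says - ln c < 2 pi \<open>kappa 2\<close>, which keeps the delay
  \<delta> at most 2 pi and thus the shift 2 pi - \<delta> nonnegative. With k =
  \<open>kappa 2\<close> the cost K exp (k \<delta>) is K exp (pi k) / sqrt c, which is U_2 / sqrt
  c.\<close>

lemma double_spiral:
  assumes "0 < c" "c < 1" "exp (- (2 * pi * kappa 2)) < c"
  shows "\<exists>k \<phi>\<^sub>1. 0 < k \<and> 0 \<le> \<phi>\<^sub>1 \<and> \<phi>\<^sub>1 \<le> 2 * pi \<and> solution_with_cost plane [1, c]
      (\<lambda>i t. if i = 0 then polar (exp (k * t)) t else polar (c * exp (k * t)) (t + \<phi>\<^sub>1))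
      (cal_U 2 / sqrt c)"
proof -
  define k where "k = kappa 2"
  define K where "K = sqrt (1 + k\<^sup>2) / k"
  have k: "0 < k"
    using kappa(1)[of 2] by (simp add: k_def)
  have K: "0 < K"
    using k by (simp add: K_def add_pos_nonneg)
  text \<open>Agent 1 trails agent 0 by the parameter \<open>\<delta>\<close> on every ray; this value balances the delays
    with which each agent exposes the points just beyond the reach of the other.\<close>
  define \<delta> where "\<delta> = pi - ln c / (2 * k)"
  have "ln c < 0"
    using assms by simp
  moreover have "- (2 * pi * k) < ln c"
    using assms ln_less_cancel_iff[of "exp (- (2 * pi * k))" c] by (simp add: k_def)
  ultimately have \<delta>: "0 < \<delta>" "\<delta> \<le> 2 * pi"
    using k pi_gt_zero by (auto simp: \<delta>_def field_simps intro: add_pos_pos)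
  have k\<delta>: "k * \<delta> = pi * k - ln c / 2"
    using k by (simp add: \<delta>_def field_simps)
  define S where "S = cal_U 2 / sqrt c"
  have S: "S = K * exp (k * \<delta>)"
  proof -
    have "exp (k * \<delta>) = exp (pi * k) / exp (ln c / 2)"
      unfolding k\<delta> by (rule exp_diff)
    also have "exp (ln c / 2) = sqrt c"
      using assms(1) by (simp add: ln_sqrt[symmetric])
    finally show ?thesis
      by (simp add: S_def cal_U_def K_def k_def)
  qed
  \<comment> \<open>Agent 0 returns after 2 pi and then serves the targets just beyond the radius c
    exp (k \<delta>) reached by agent 1; the equation says that its cost ratio is again S.\<close>
  have balance: "K * exp (k * (2 * pi)) = S * (c * exp (k * \<delta>))"
  proof -
    have "exp (k * \<delta>) * c * exp (k * \<delta>) = exp (k * \<delta> + ln c + k * \<delta>)"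
      unfolding exp_add using assms(1) by simp
    also have "k * \<delta> + ln c + k * \<delta> = k * (2 * pi)"
      unfolding k\<delta> by simp
    finally show ?thesis
      by (simp add: S)
  qed
  define \<tau> where "\<tau> i t = (if i = 0 then polar (exp (k * t)) t else polar (c * exp (k * t)) (t + (2 * pi - \<delta>)))"
    for i :: nat and t
  define l where "l i t = (if i = 0 then K * (1 * exp (k * t)) else K * (c * exp (k * t)))" for i :: nat and t
  have "solution_with_cost plane [1, c] \<tau> S"
  proof (rule solution_with_costI[where r = 1 and l = l])
    show "0 \<le> S"
      using K by (simp add: S)
    show "arc_length (\<tau> i) (l i) \<and> 0 < [1, c] ! i" if "i < length [1, c]" for i
      using less_two_cases[OF that] arc_length_spiral[OF zero_less_one k, of 0, folded K_def]
        arc_length_spiral[OF assms(1) k, of "2 * pi - \<delta>", folded K_def] assms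
      unfolding \<tau>_def[abs_def] l_def[abs_def] by (elim disjE) simp_all
  next
    fix A assume "A \<in> plane"
    then obtain y \<psi> where y: "0 < y" and A: "A = polar y \<psi>"
      by (rule plane_polarE)
    obtain j :: int where j: "exp (k * (\<psi> + 2 * pi * of_int j)) < y" "y \<le> exp (k * (\<psi> + 2 * pi * of_int j + 2 * pi))"
      using spiral_bracket[OF k y] .
    define t where "t = \<psi> + 2 * pi * of_int j"
    have t2: "t + 2 * pi = \<psi> + 2 * pi * of_int (j + 1)"
      by (simp add: t_def algebra_simps)
    show "\<exists>i<length [1, c]. \<exists>t. exposes (\<tau> i t) A \<and> l i t \<le> S * [1, c] ! i * norm A"
    proof (cases "y \<le> c * exp (k * (t + \<delta>))")
      case True
      have "t + \<delta> + (2 * pi - \<delta>) = \<psi> + 2 * pi * of_int (j + 1)"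
        using t2 by simp
      then have "exposes (\<tau> 1 (t + \<delta>)) A"
        unfolding A \<tau>_def using True y assms(1) by (auto simp: exposes_polar_polar_iff intro!: exI[of _ "j + 1"])
      moreover have "l 1 (t + \<delta>) = S * c * exp (k * t)"
        by (simp add: l_def S distrib_left exp_add)
      moreover have "S * c * exp (k * t) \<le> S * c * y"
        using j(1) K assms by (intro mult_left_mono) (auto simp: t_def S)
      ultimately show ?thesis
        using y by (intro exI[of _ 1] conjI exI[of _ "t + \<delta>"]) (simp_all add: A)
    next
      case False
      have "exposes (\<tau> 0 (t + 2 * pi)) A"
        unfolding A \<tau>_def using j(2) y t2 by (auto simp: exposes_polar_polar_iff t_def intro!: exI[of _ "j + 1"])
      moreover have "l 0 (t + 2 * pi) = S * (c * exp (k * (t + \<delta>)))"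
        using balance by (simp add: l_def distrib_left exp_add)
      moreover have "S * (c * exp (k * (t + \<delta>))) \<le> S * y"
        using False K by (intro mult_left_mono) (auto simp: S)
      ultimately show ?thesis
        using y by (intro exI[of _ 0] conjI exI[of _ "t + 2 * pi"]) (simp_all add: A)
    qed
  next
    fix x :: real assume x: "1 < x"
    have 0: "S \<le> l 0 t" if ex: "exposes (\<tau> 0 t) (polar x 0)" for t
    proof -
      obtain j :: int where j: "x \<le> exp (k * t)" "t = 2 * pi * of_int j"
        using ex x by (auto simp: \<tau>_def exposes_polar_polar_iff)
      then have "1 < exp (k * t)"
        using x by linarith
      then have "0 < t"
        using k by (simp add: zero_less_mult_iff)
      then have "1 \<le> j"
        unfolding j(2) by (simp add: zero_less_mult_iff)
      then have "2 * pi * 1 \<le> 2 * pi * of_int j"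
        by (intro mult_left_mono) auto
      then have "\<delta> \<le> t"
        using \<delta>(2) j(2) by linarith
      then show ?thesis
        using k K by (simp add: l_def S)
    qed
    have 1: "S * c \<le> l 1 t" if ex: "exposes (\<tau> 1 t) (polar x 0)" for t
    proof -
      obtain j :: int where j: "x \<le> c * exp (k * t)" "t + (2 * pi - \<delta>) = 2 * pi * of_int j"
        using ex x assms(1) by (auto simp: \<tau>_def exposes_polar_polar_iff)
      have "c * exp (k * t) \<le> 1 * exp (k * t)"
        using assms by (intro mult_right_mono) auto
      then have "1 < exp (k * t)"
        using x j(1) by linarith
      then have "0 < t"
        using k by (simp add: zero_less_mult_iff)
      \<comment> \<open>Since c < 1, exposing x > 1 forces t > 0; together with \<delta> \<le> 2 pi
        this leaves j \<ge> 1, that is t \<ge> \<delta>.\<close>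
      then have "0 < 2 * pi * of_int j"
        using \<delta> j(2) by linarith
      then have "1 \<le> j"
        by (simp add: zero_less_mult_iff)
      then have "2 * pi * 1 \<le> 2 * pi * of_int j"
        by (intro mult_left_mono) auto
      then have "\<delta> \<le> t"
        using j(2) by linarith
      then have "S * c \<le> K * exp (k * t) * c"
        using k K assms by (intro mult_right_mono) (auto simp: S)
      then show ?thesis
        by (simp add: l_def mult_ac)
    qed
    show "\<exists>A\<in>plane. norm A = x * 1 \<and>
        (\<forall>i<length [1, c]. \<forall>t. exposes (\<tau> i t) A \<longrightarrow> S * [1, c] ! i * 1 \<le> l i t)"
      using x 0 1 by (intro bexI[of _ "polar x 0"]) (auto simp: less_Suc_eq polar_in_plane)
  qed simp
  then have "solution_with_cost plane [1, c]
      (\<lambda>i t. if i = 0 then polar (exp (k * t)) t else polar (c * exp (k * t)) (t + (2 * pi - \<delta>))) (cal_U 2 / sqrt c)"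
    by (simp only: \<tau>_def[abs_def] S_def)
  then show ?thesis
    using k \<delta> by (intro exI[of _ k] exI[of _ "2 * pi - \<delta>"]) auto
qed

text \<open>Makes \<open>double_spiral\<close> applicable for all c \<ge> 0.268872. The quadratic
  Taylor bound suffices: exp 1.758 \<ge> 4.3, and 1 / 4.3 < 0.268872.\<close>

lemma exp_kappa_2: "exp (- (2 * pi * kappa 2)) < 0.268872"
proof -
  have "0.28 < kappa 2"
    by (rule less_kappa) (use pi_approx(2) in \<open>simp_all add: field_simps power3_eq_cube\<close>)
  have "3.1415 * 0.28 < pi * kappa 2"
    using pi_approx(1) \<open>0.28 < kappa 2\<close> by (intro mult_strict_mono) auto
  then have "1.758 \<le> 2 * pi * kappa 2"
    by simp
  moreover have "1 + x + x\<^sup>2 / 2 \<le> exp x" if "0 \<le> x" for x :: real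
    using exp_lower_Taylor_quadratic[OF that] .
  from this[of "1.758"] have "4.3 \<le> exp (1.758 :: real)"
    by (simp add: power2_eq_square)
  ultimately have "4.3 \<le> exp (2 * pi * kappa 2)"
    using exp_le_cancel_iff[of "1.758" "2 * pi * kappa 2"] by linarith
  then have "1 / exp (2 * pi * kappa 2) \<le> 1 / 4.3"
    by (intro divide_left_mono) auto
  then show ?thesis
    by (simp add: exp_minus inverse_eq_divide)
qed

lemma cone_partition:
  assumes "0 < c" "0 < \<phi>" "\<phi> < pi" "tan (\<phi> / 2) \<le> 0.42" "gamma_fun \<phi> = c"
  shows "\<exists>\<tau>. solution_with_cost plane [1, c] \<tau> (cal_R \<phi>)
    \<and> (\<forall>A\<in>conic_complement \<phi>. \<exists>t. exposes (\<tau> 0 t) A)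
    \<and> (\<forall>A\<in>plane_cone \<phi>. \<exists>t. exposes (\<tau> 1 t) A)
    \<and> search_cost (conic_complement \<phi>) [1] (\<lambda>_. \<tau> 0) \<le> ennreal (cal_R \<phi>)
    \<and> search_cost (plane_cone \<phi>) [c] (\<lambda>_. \<tau> 1) \<le> ennreal (cal_R \<phi>)"
proof -
  let ?R = "cal_R \<phi>"
  have R: "0 < ?R"
    using assms(2,3) by (rule cal_R_pos)
  obtain s where s: "s \<in> {1 / cal_U 1..cal_U 1}" "?R = R_cost s \<phi>"
    by (rule cal_R_attained[OF assms(2,3)]) blast
  have "0 < 1 / cal_U 1"
    using cal_U_1_pos by simp
  then have "0 < s"
    using s(1) by (meson atLeastAtMost_iff less_le_trans)
  from complement_curve[OF this assms(2,3), folded s(2)] obtain \<tau>0 l0 r where \<tau>0: "arc_length \<tau>0 l0" "0 < r"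
    and W: "\<And>A. A \<in> conic_complement \<phi> \<Longrightarrow> \<exists>t. exposes (\<tau>0 t) A \<and> l0 t \<le> ?R * norm A"
    and late: "\<And>x t. 1 < x \<Longrightarrow> exposes (\<tau>0 t) (polar (x * r) pi) \<Longrightarrow> ?R * r \<le> l0 t"
    by metis
  obtain y where y: "2 \<le> y" "tan (\<phi> / 2) * y \<le> 5.14" "cal_F \<phi> = F_cost y (tan (\<phi> / 2))"
    by (rule cal_F_attained[OF assms(2-4)]) blast
  \<comment> \<open>Here \<open>gamma_fun \<phi> = c\<close> enters: the length ratio of the zigzag
    is R times its speed, so both agents obey the same cost bound.\<close>
  have cost: "cos (\<phi> / 2) * cal_F \<phi> = ?R * c"
    using assms(5) R by (simp add: gamma_fun_def field_simps)
  from zigzag_curve[OF assms(2-4) y(1,2), folded y(3), unfolded cost] obtain \<tau>1 l1 where \<tau>1: "arc_length \<tau>1 l1"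
    and C: "\<And>A. A \<in> plane_cone \<phi> \<Longrightarrow> \<exists>t. exposes (\<tau>1 t) A \<and> l1 t \<le> ?R * c * norm A"
    and never: "\<And>t z. 0 < z \<Longrightarrow> \<not> exposes (\<tau>1 t) (polar z pi)"
    by metis
  define \<tau> where "\<tau> i = (if i = 0 then \<tau>0 else \<tau>1)" for i :: nat
  have agents: "\<tau> 0 = \<tau>0" "\<tau> 1 = \<tau>1"
    by (simp_all add: \<tau>_def)
  define l where "l i = (if i = 0 then l0 else l1)" for i :: nat
  have "solution_with_cost plane [1, c] \<tau> ?R"
  proof (rule solution_with_costI[where r = r and l = l])
    show "arc_length (\<tau> i) (l i) \<and> 0 < [1, c] ! i" if "i < length [1, c]" for i
      using less_two_cases[OF that] \<tau>0(1) \<tau>1 assms(1) unfolding \<tau>_def l_def by (elim disjE) simp_all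
  next
    fix A assume A: "A \<in> plane"
    show "\<exists>i<length [1, c]. \<exists>t. exposes (\<tau> i t) A \<and> l i t \<le> ?R * [1, c] ! i * norm A"
    proof (cases "A \<in> plane_cone \<phi>")
      case True
      then show ?thesis
        using C[OF True] by (intro exI[of _ 1]) (simp add: \<tau>_def l_def)
    next
      case False
      then have "A \<in> conic_complement \<phi>"
        using A by (simp add: conic_complement_def)
      then show ?thesis
        using W by (intro exI[of _ 0]) (simp add: \<tau>_def l_def)
    qed
  next
    fix x :: real assume x: "1 < x"
    then have "0 < x * r"
      using \<tau>0(2) by simp
    then show "\<exists>A\<in>plane. norm A = x * r \<and>
        (\<forall>i<length [1, c]. \<forall>t. exposes (\<tau> i t) A \<longrightarrow> ?R * [1, c] ! i * r \<le> l i t)"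
      using late[OF x] never[of "x * r"]
      by (intro bexI[of _ "polar (x * r) pi"]) (auto simp: less_Suc_eq polar_in_plane \<tau>_def l_def)
  qed (use R \<tau>0 in auto)
  moreover have "search_cost (conic_complement \<phi>) [1] (\<lambda>_. \<tau> 0) \<le> ennreal ?R"
  proof (rule search_cost_le)
    fix A assume "A \<in> conic_complement \<phi>"
    then obtain t where "exposes (\<tau>0 t) A" "l0 t \<le> ?R * norm A"
      using W by blast
    then show "\<exists>i<length [1::real]. search_curve (\<tau> 0) \<and> 0 < [1::real] ! i \<and>
        (\<exists>t. exposes (\<tau> 0 t) A \<and> path_len (\<tau> 0) t \<le> ennreal (?R * [1::real] ! i * norm A))"
      using \<tau>0(1) by (auto simp: \<tau>_def arc_length_def intro!: exI[of _ t] ennreal_leI)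
  qed (use R in simp)
  moreover have "search_cost (plane_cone \<phi>) [c] (\<lambda>_. \<tau> 1) \<le> ennreal ?R"
  proof (rule search_cost_le)
    fix A assume "A \<in> plane_cone \<phi>"
    then obtain t where "exposes (\<tau>1 t) A" "l1 t \<le> ?R * c * norm A"
      using C by blast
    then show "\<exists>i<length [c]. search_curve (\<tau> 1) \<and> 0 < [c] ! i \<and>
        (\<exists>t. exposes (\<tau> 1 t) A \<and> path_len (\<tau> 1) t \<le> ennreal (?R * [c] ! i * norm A))"
      using \<tau>1 assms(1) by (auto simp: \<tau>_def arc_length_def intro!: exI[of _ t] ennreal_leI)
  qed (use R in simp)
  moreover have "\<forall>A\<in>conic_complement \<phi>. \<exists>t. exposes (\<tau> 0 t) A" "\<forall>A\<in>plane_cone \<phi>. \<exists>t. exposes (\<tau> 1 t) A"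
    using W C unfolding agents by blast+
  ultimately show ?thesis
    by blast
qed

theorem theorem6:
  fixes c :: real
  assumes "0 < c" and "c \<le> 0.5"
  shows "(c \<le> 0.0578391 \<longrightarrow> (\<exists>\<tau>. solution_with_cost plane [1, c] \<tau> (cal_U 1)))
    \<and> (0.0578391 < c \<and> c < 0.268872 \<longrightarrow>
        (\<exists>\<phi>. 0 < \<phi> \<and> \<phi> < pi \<and> gamma_fun \<phi> = c \<and> cal_R \<phi> < cal_U 1
          \<and> (\<exists>\<tau>. solution_with_cost plane [1, c] \<tau> (cal_R \<phi>)
               \<and> (\<forall>A\<in>conic_complement \<phi>. \<exists>t. exposes (\<tau> 0 t) A)
               \<and> (\<forall>A\<in>plane_cone \<phi>. \<exists>t. exposes (\<tau> 1 t) A)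
               \<and> search_cost (conic_complement \<phi>) [1] (\<lambda>_. \<tau> 0) \<le> ennreal (cal_R \<phi>)
               \<and> search_cost (plane_cone \<phi>) [c] (\<lambda>_. \<tau> 1) \<le> ennreal (cal_R \<phi>))))
    \<and> (c \<ge> 0.268872 \<longrightarrow>
        (\<exists>k \<phi>\<^sub>1. k > 0 \<and> 0 \<le> \<phi>\<^sub>1 \<and> \<phi>\<^sub>1 \<le> 2 * pi
          \<and> solution_with_cost plane [1, c]
              (\<lambda>i t. if i = 0 then polar (exp (k * t)) t
                     else polar (c * exp (k * t)) (t + \<phi>\<^sub>1))
              (cal_U 2 / sqrt c)))"
proof (intro conjI impI)
  show "\<exists>\<tau>. solution_with_cost plane [1, c] \<tau> (cal_U 1)"
    using assms(1) by (rule single_spiral)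
next
  assume c: "0.0578391 < c \<and> c < 0.268872"
  then obtain \<phi> where \<phi>: "0 < \<phi>" "\<phi> < pi" "tan (\<phi> / 2) \<le> 0.42" "gamma_fun \<phi> = c"
    using gamma_fun_attains[of c] by blast
  show "\<exists>\<phi>. 0 < \<phi> \<and> \<phi> < pi \<and> gamma_fun \<phi> = c \<and> cal_R \<phi> < cal_U 1
      \<and> (\<exists>\<tau>. solution_with_cost plane [1, c] \<tau> (cal_R \<phi>)
           \<and> (\<forall>A\<in>conic_complement \<phi>. \<exists>t. exposes (\<tau> 0 t) A)
           \<and> (\<forall>A\<in>plane_cone \<phi>. \<exists>t. exposes (\<tau> 1 t) A)
           \<and> search_cost (conic_complement \<phi>) [1] (\<lambda>_. \<tau> 0) \<le> ennreal (cal_R \<phi>)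
           \<and> search_cost (plane_cone \<phi>) [c] (\<lambda>_. \<tau> 1) \<le> ennreal (cal_R \<phi>))"
    using \<phi> cal_R_less[OF \<phi>(1,2)] cone_partition[OF assms(1) \<phi>] by blast
next
  assume "c \<ge> 0.268872"
  then show "\<exists>k \<phi>\<^sub>1. k > 0 \<and> 0 \<le> \<phi>\<^sub>1 \<and> \<phi>\<^sub>1 \<le> 2 * pi
      \<and> solution_with_cost plane [1, c]
          (\<lambda>i t. if i = 0 then polar (exp (k * t)) t
                 else polar (c * exp (k * t)) (t + \<phi>\<^sub>1))
          (cal_U 2 / sqrt c)"
    using assms exp_kappa_2 by (intro double_spiral) auto
qed

end
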